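(* $\mathrm{Homeo}_+(\mathcal S)=\mathrm{Homeo}_+^{p}(\mathcal S)\cup\mathrm{Homeo}_+^{lp}(\mathcal S)$. Moreover, $\mathrm{Homeo}_+^{p}(\mathcal S)$ is a dense subgroup of $\mathrm{Homeo}_+(\mathcal S)$.
   Context: Universal one-dimensional solenoid: $\mathcal S=\varprojlim_n \mathbb R/n\mathbb Z$ (index set $\mathbb Z_+$ ordered by divisibility, bonding maps the canonical projections), a compact connected abelian topological group. Let $\widehat{\mathbb Z}=\varprojlim_n\mathbb Z/n\mathbb Z$, with $\mathbb Z\subset\widehat{\mathbb Z}$ densely. Equivalently $\mathcal S$ is the orbit space of $\mathbb R\times\widehat{\mathbb Z}$ under the $\mathbb Z$-action $t\cdot(x,k)=(x+t,k-t)$, with projection $p:\mathbb R\times\widehat{\mathbb Z}\to\mathcal S$. $\mathrm{Homeo}_+(\mathcal S)$ is the group of orientation-preserving (along leaves) homeomorphisms of $\mathcal S$ isotopic to the identity, with the topology of uniform convergence. Each $f\in\mathrm{Homeo}_+(\mathcal S)$ has a lift $F$ ($p\circ F=f\circ p$) of the form $F(x,k)=(F_k(x),k)$, where each $F_k$ is an increasing homeomorphism of $\mathbb R$, $F$ is continuous, $F_{k-t}(x+t)=F_k(x)+t$ for all $t\in\mathbb Z$, and the displacement function $\delta_k=F_k-\mathrm{id}$ is bounded and continuous. A continuous function $\mathbb R\to\mathbb R$ is periodic if it has a nonzero period (constants included), limit periodic if it is a uniform limit on $\mathbb R$ of continuous periodic functions, and purely limit periodic if it is limit periodic but not periodic.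 $\mathrm{Homeo}_+^{p}(\mathcal S)$ (resp. $\mathrm{Homeo}_+^{lp}(\mathcal S)$) is the set of $f\in\mathrm{Homeo}_+(\mathcal S)$ whose displacement functions $\delta_k$, $k\in\widehat{\mathbb Z}$, are periodic (resp. purely limit periodic). *)

theory Defs
  imports "HOL-Analysis.Analysis" "HOL-Algebra.Bij"
begin

section \<open>The inverse limits of \<open>\<real>/n\<int>\<close> and \<open>\<int>/n\<int>\<close>\<close>

text \<open>
  Both inverse limits are instances of one construction, for a topological ring \<open>'a\<close>: the limit
  of the quotients of \<open>'a\<close> by \<open>n\<int>\<close>, over the integers \<open>n \<ge> 1\<close> ordered by divisibility. The
  type \<open>real\<close> gives the solenoid, and \<open>int\<close> (whose topology is discrete) gives the
  profinite integers. An element of a quotient is a coset, so an element of a limit is a family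
  of cosets; it is extensional (\<open>undefined\<close> at the index 0), as \<^const>\<open>product_topology\<close> requires.
\<close>

definition cls :: "nat \<Rightarrow> 'a::ring_1 \<Rightarrow> 'a set" where
  "cls n x = {x + of_int j * of_nat n | j. True}"

definition quot_top :: "nat \<Rightarrow> 'a::{ring_1,topological_space} set topology" where
  "quot_top n = topology (\<lambda>U. U \<subseteq> range (cls n) \<and> open (cls n -` U))"

lemma istopology_quot:
  "istopology (\<lambda>U. U \<subseteq> range (cls n) \<and> open (cls n -` U :: 'a::{ring_1,topological_space} set))"
  unfolding istopology_def
proof (intro conjI allI impI)
  fix A B :: "'a set set"
  assume A: "A \<subseteq> range (cls n) \<and> open (cls n -` A)"
    and B: "B \<subseteq> range (cls n) \<and> open (cls n -` B)"
  show "A \<inter> B \<subseteq> range (cls n)" using A by blast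
  show "open (cls n -` (A \<inter> B))" using A B by (simp add: open_Int)
next
  fix \<K> :: "'a set set set"
  assume K: "\<forall>K\<in>\<K>. K \<subseteq> range (cls n) \<and> open (cls n -` K)"
  show "\<Union>\<K> \<subseteq> range (cls n)" using K by blast
  show "open (cls n -` \<Union>\<K>)" using K unfolding vimage_Union by blast
qed

lemma openin_quot_top:
  "openin (quot_top n) U \<longleftrightarrow> U \<subseteq> range (cls n) \<and> open (cls n -` U)"
  unfolding quot_top_def by (simp add: topology_inverse'[OF istopology_quot])

lemma topspace_quot_top:
  "topspace (quot_top n) = range (cls n :: 'a::{ring_1,topological_space} \<Rightarrow> 'a set)"
proof
  show "topspace (quot_top n) \<subseteq> range (cls n :: 'a \<Rightarrow> 'a set)"
    using openin_quot_top[of n "topspace (quot_top n) :: 'a set set"] by simp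
  have "cls n -` range (cls n) = (UNIV :: 'a set)" by blast
  then have "openin (quot_top n) (range (cls n :: 'a \<Rightarrow> 'a set))"
    by (simp add: openin_quot_top)
  then show "range (cls n :: 'a \<Rightarrow> 'a set) \<subseteq> topspace (quot_top n)"
    by (rule openin_subset)
qed

text \<open>The canonical projection to the quotient by \<open>m\<int>\<close>, defined on cosets of \<open>n\<int>\<close> for \<open>m\<close> dividing \<open>n\<close>.\<close>

definition bond :: "nat \<Rightarrow> 'a::ring_1 set \<Rightarrow> 'a set" where
  "bond m A = (\<Union>a\<in>A. cls m a)"

definition invlim :: "(nat \<Rightarrow> 'a::ring_1 set) set" where
  "invlim = {s \<in> (\<Pi>\<^sub>E n\<in>{1..}. range (cls n)).
     \<forall>m\<ge>1. \<forall>n\<ge>1. m dvd n \<longrightarrow> bond m (s n) = s m}"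

definition invlim_top :: "(nat \<Rightarrow> 'a::{ring_1,topological_space} set) topology" where
  "invlim_top = subtopology (product_topology quot_top {1..}) invlim"

definition invlim_diff ::
  "(nat \<Rightarrow> 'a::ring_1 set) \<Rightarrow> (nat \<Rightarrow> 'a set) \<Rightarrow> (nat \<Rightarrow> 'a set)" where
  "invlim_diff s t = (\<lambda>n\<in>{1..}. {a - b | a b. a \<in> s n \<and> b \<in> t n})"

definition emb :: "'a::ring_1 \<Rightarrow> nat \<Rightarrow> 'a set" where
  "emb x = (\<lambda>n\<in>{1..}. cls n x)"

type_synonym sol = "nat \<Rightarrow> real set"
type_synonym zhat = "nat \<Rightarrow> int set"

abbreviation solenoid :: "sol set" where "solenoid \<equiv> invlim"
abbreviation solenoid_top :: "sol topology" where "solenoid_top \<equiv> invlim_top"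
abbreviation Zhat :: "zhat set" where "Zhat \<equiv> invlim"
abbreviation Zhat_top :: "zhat topology" where "Zhat_top \<equiv> invlim_top"

text \<open>
  The projection \<open>p\<close> from \<open>\<real> \<times> Zhat\<close> to the solenoid, \<open>p (x, k) = x + k\<close> coordinatewise; its fibres
  are the orbits of the action \<open>t \<cdot> (x, k) = (x + t, k - t)\<close> of \<open>\<int>\<close>.
\<close>

definition sol_proj :: "real \<Rightarrow> zhat \<Rightarrow> sol" where
  "sol_proj x k = (\<lambda>n\<in>{1..}. (\<lambda>j. x + of_int j) ` k n)"


section \<open>The group of homeomorphisms\<close>

definition inc_homeo :: "(real \<Rightarrow> real) \<Rightarrow> bool" where
  "inc_homeo g \<longleftrightarrow> strict_mono g \<and> homeomorphic_map euclidean euclidean g"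

text \<open>The leaves (path components) of the solenoid are parametrised by the maps \<open>\<lambda>x. sol_proj x k\<close>.\<close>

definition leaf_orientation_preserving :: "(sol \<Rightarrow> sol) \<Rightarrow> bool" where
  "leaf_orientation_preserving f \<longleftrightarrow>
     (\<forall>k\<in>Zhat. \<exists>k'\<in>Zhat. \<exists>g. inc_homeo g \<and> (\<forall>x. f (sol_proj x k) = sol_proj (g x) k'))"

definition isotopic_to_id :: "(sol \<Rightarrow> sol) \<Rightarrow> bool" where
  "isotopic_to_id f \<longleftrightarrow>
     (\<exists>H. continuous_map (prod_topology (top_of_set {0..1::real}) solenoid_top) solenoid_top H \<and>
          (\<forall>t\<in>{0..1}. homeomorphic_map solenoid_top solenoid_top (\<lambda>s. H (t, s))) \<and>
          (\<forall>s\<in>solenoid. H (0, s) = s \<and> H (1, s) = f s))"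

definition Homeo_plus :: "(sol \<Rightarrow> sol) set" where
  "Homeo_plus = {f \<in> extensional solenoid. homeomorphic_map solenoid_top solenoid_top f \<and>
     leaf_orientation_preserving f \<and> isotopic_to_id f}"

definition Homeo_plus_group :: "(sol \<Rightarrow> sol) monoid" where
  "Homeo_plus_group = (BijGroup solenoid)\<lparr>carrier := Homeo_plus\<rparr>"

text \<open>
  The topology of uniform convergence, for the uniform structure of the solenoid as a topological
  group. The solenoid being compact, this is also the topology of uniform convergence for any
  metric inducing the topology of the solenoid.
\<close>

definition unif_nbhd :: "(sol \<Rightarrow> sol) \<Rightarrow> sol set \<Rightarrow> (sol \<Rightarrow> sol) set" where
  "unif_nbhd f V = {g \<in> Homeo_plus. \<forall>s\<in>solenoid. invlim_diff (g s) (f s) \<in> V}"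

definition Homeo_plus_top :: "(sol \<Rightarrow> sol) topology" where
  "Homeo_plus_top = topology (\<lambda>U. U \<subseteq> Homeo_plus \<and>
     (\<forall>f\<in>U. \<exists>V. openin solenoid_top V \<and> emb 0 \<in> V \<and> unif_nbhd f V \<subseteq> U))"

lemma istopology_Homeo_plus:
  "istopology (\<lambda>U. U \<subseteq> Homeo_plus \<and>
     (\<forall>f\<in>U. \<exists>V. openin solenoid_top V \<and> emb 0 \<in> V \<and> unif_nbhd f V \<subseteq> U))"
  (is "istopology ?P")
  unfolding istopology_def
proof (intro conjI allI impI)
  fix A B assume A: "?P A" and B: "?P B"
  show "A \<inter> B \<subseteq> Homeo_plus" using A by (simp add: le_infI1)
  show "\<forall>f\<in>A \<inter> B. \<exists>V. openin solenoid_top V \<and> emb 0 \<in> V \<and> unif_nbhd f V \<subseteq> A \<inter> B"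
  proof
    fix f assume f: "f \<in> A \<inter> B"
    obtain V where V: "openin solenoid_top V" "emb 0 \<in> V" "unif_nbhd f V \<subseteq> A"
      using A f by (metis IntD1)
    obtain W where W: "openin solenoid_top W" "emb 0 \<in> W" "unif_nbhd f W \<subseteq> B"
      using B f by (metis IntD2)
    have "unif_nbhd f (V \<inter> W) \<subseteq> unif_nbhd f V \<inter> unif_nbhd f W"
      by (simp add: unif_nbhd_def subset_iff)
    with V(3) W(3) have "unif_nbhd f (V \<inter> W) \<subseteq> A \<inter> B"
      by (meson Int_mono order_trans)
    then show "\<exists>V. openin solenoid_top V \<and> emb 0 \<in> V \<and> unif_nbhd f V \<subseteq> A \<inter> B"
      using V W by (intro exI[of _ "V \<inter> W"] conjI openin_Int IntI)
  qed
next
  fix \<K> assume K: "\<forall>K\<in>\<K>. ?P K"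
  show "\<Union>\<K> \<subseteq> Homeo_plus" using K by (simp add: Sup_le_iff)
  show "\<forall>f\<in>\<Union>\<K>. \<exists>V. openin solenoid_top V \<and> emb 0 \<in> V \<and> unif_nbhd f V \<subseteq> \<Union>\<K>"
  proof
    fix f assume "f \<in> \<Union>\<K>"
    then obtain K where *: "K \<in> \<K>" "f \<in> K" by (rule UnionE)
    from K * obtain V where "openin solenoid_top V" "emb 0 \<in> V" "unif_nbhd f V \<subseteq> K"
      by meson
    with *(1) show "\<exists>V. openin solenoid_top V \<and> emb 0 \<in> V \<and> unif_nbhd f V \<subseteq> \<Union>\<K>"
      by (meson Union_upper order_trans)
  qed
qed


section \<open>Lifts, displacement functions and limit periodicity\<close>

definition displacement :: "(zhat \<Rightarrow> real \<Rightarrow> real) \<Rightarrow> zhat \<Rightarrow> real \<Rightarrow> real" where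
  "displacement F k = (\<lambda>x. F k x - x)"

text \<open>
  The family \<open>F\<close> encodes the lift \<open>(x, k) \<mapsto> (F k x, k)\<close>. Such a lift is unique: as
  \<open>\<int>\<close> embeds in the profinite integers, \<open>\<lambda>x. sol_proj x k\<close> is injective for each \<open>k\<close>.
\<close>

definition is_lift :: "(sol \<Rightarrow> sol) \<Rightarrow> (zhat \<Rightarrow> real \<Rightarrow> real) \<Rightarrow> bool" where
  "is_lift f F \<longleftrightarrow>
     (\<forall>k\<in>Zhat. \<forall>x. sol_proj (F k x) k = f (sol_proj x k)) \<and>
     (\<forall>k\<in>Zhat. inc_homeo (F k)) \<and>
     continuous_map (prod_topology euclidean Zhat_top) (prod_topology euclidean Zhat_top)
       (\<lambda>(x, k). (F k x, k)) \<and>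
     (\<forall>k\<in>Zhat. \<forall>t::int. \<forall>x. F (invlim_diff k (emb t)) (x + of_int t) = F k x + of_int t) \<and>
     (\<forall>k\<in>Zhat. bounded (range (displacement F k)) \<and> continuous_on UNIV (displacement F k))"

definition periodic :: "(real \<Rightarrow> real) \<Rightarrow> bool" where
  "periodic h \<longleftrightarrow> continuous_on UNIV h \<and> (\<exists>T. T \<noteq> 0 \<and> (\<forall>x. h (x + T) = h x))"

definition limit_periodic :: "(real \<Rightarrow> real) \<Rightarrow> bool" where
  "limit_periodic h \<longleftrightarrow> continuous_on UNIV h \<and>
     (\<exists>u. (\<forall>n::nat. periodic (u n)) \<and> uniform_limit UNIV u h sequentially)"

definition purely_limit_periodic :: "(real \<Rightarrow> real) \<Rightarrow> bool" where
  "purely_limit_periodic h \<longleftrightarrow> limit_periodic h \<and> \<not> periodic h"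

definition Homeo_plus_p :: "(sol \<Rightarrow> sol) set" where
  "Homeo_plus_p = {f \<in> Homeo_plus.
     \<exists>F. is_lift f F \<and> (\<forall>k\<in>Zhat. periodic (displacement F k))}"

definition Homeo_plus_lp :: "(sol \<Rightarrow> sol) set" where
  "Homeo_plus_lp = {f \<in> Homeo_plus.
     \<exists>F. is_lift f F \<and> (\<forall>k\<in>Zhat. purely_limit_periodic (displacement F k))}"

end

theory Submission
  imports Defs
begin

text \<open>
  An isotopy from the identity lifts through \<open>\<real> \<rightarrow> \<real>/\<int>\<close>, so every \<open>f\<close> in the group has the form
  \<open>s \<mapsto> s + \<phi> s\<close> for a continuous \<open>\<phi>\<close> on the solenoid, and \<open>\<phi>\<close> restricted to the leaf of \<open>k\<close>
  is the displacement \<open>\<delta>\<^sub>k\<close>. By compactness \<open>\<phi>\<close> depends on one coordinate \<open>n\<close> only, up to \<open>\<epsilon>\<close>, so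
  \<open>n\<int>\<close> consists of \<open>\<epsilon>\<close>-almost periods of all \<open>\<delta>\<^sub>k\<close>; rescaling a lift on \<open>[0, n]\<close> turns it into
  a nearby homeomorphism commuting with the translation by \<open>n\<close>. This gives both limit periodicity and
  density. Leaves are dense, so one periodic \<open>\<delta>\<^sub>k\<close> makes all of them periodic; moreover a
  periodic \<open>\<delta>\<^sub>k\<close> has an integer period, so two periodic homeomorphisms have a common period
  and the periodic ones form a subgroup.
\<close>

section \<open>Increasing homeomorphisms of the line and their periods\<close>

text \<open>The isotopy is what keeps each leaf in place: it moves \<open>s\<close> to
  \<open>f s\<close> along the leaf of \<open>s\<close>, and \<phi> records the signed distance.
  Orientation along leaves then makes \<open>x + \<delta>\<^sub>k x\<close> increasing. Periodic
  functions near \<open>\<delta>\<^sub>k\<close> would give limit periodicity but not density, since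
  the approximants must again be displacements of homeomorphisms. This is why the lift, and not its
  displacement, is approximated. An integer period is essential to the group structure:
  displacements with incommensurable periods could compose to a nonperiodic one. No metric on the
  solenoid is fixed. Points are tested by the characters exp (2\<pi>ix/n), which turn equality of
  points and continuity into statements about complex functions; uniform estimates come from
  compactness of the set of pairs that violate them.\<close>

lemma strict_mono_surj_continuous:
  fixes g :: "'a::linorder_topology \<Rightarrow> 'b::linorder_topology"
  assumes "strict_mono g" "surj g"
  shows "continuous_on UNIV g"
proof -
  have "(g \<longlongrightarrow> g x) (at x)" for x
  proof (rule order_tendstoI)
    fix y assume "y < g x"
    obtain a where a: "g a = y" using assms(2) by (metis surjD)
    then have "a < x" using \<open>y < g x\<close> assms(1) by (metis strict_mono_less)
    then have "eventually (\<lambda>z. a < z) (at x)" using order_tendstoD(1)[OF tendsto_ident_at] by blast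
    then show "eventually (\<lambda>z. y < g z) (at x)"
      by (rule eventually_mono) (use a assms(1) in \<open>auto simp: strict_mono_less\<close>)
  next
    fix y assume "g x < y"
    obtain a where a: "g a = y" using assms(2) by (metis surjD)
    then have "x < a" using \<open>g x < y\<close> assms(1) by (metis strict_mono_less)
    then have "eventually (\<lambda>z. z < a) (at x)" using order_tendstoD(2)[OF tendsto_ident_at] by blast
    then show "eventually (\<lambda>z. g z < y) (at x)"
      by (rule eventually_mono) (use a assms(1) in \<open>auto simp: strict_mono_less\<close>)
  qed
  then show ?thesis by (simp add: continuous_on_def)
qed

text \<open>A strictly increasing bijection has a strictly increasing inverse, and both are
  continuous by order alone. Later maps are checked only for monotonicity and surjectivity.\<close>

lemma inc_homeo_iff: "inc_homeo g \<longleftrightarrow> strict_mono g \<and> surj g"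
proof
  assume "inc_homeo g"
  then show "strict_mono g \<and> surj g"
    using homeomorphic_imp_surjective_map by (fastforce simp: inc_homeo_def)
next
  assume g: "strict_mono g \<and> surj g"
  then have "inj g" by (simp add: strict_mono_imp_inj_on)
  have "strict_mono (inv_into UNIV g)"
    using g strict_mono_less[of g "inv_into UNIV g _" "inv_into UNIV g _"]
    by (intro strict_monoI) (simp add: surj_f_inv_f)
  moreover have "surj (inv_into UNIV g)" using \<open>inj g\<close> by (rule inj_imp_surj_inv)
  ultimately have "continuous_on UNIV (inv_into UNIV g)" by (rule strict_mono_surj_continuous)
  then have "homeomorphic_maps euclidean euclidean g (inv_into UNIV g)"
    using g \<open>inj g\<close>
    by (simp add: homeomorphic_maps_def strict_mono_surj_continuous surj_f_inv_f)
  then show "inc_homeo g"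
    using g homeomorphic_maps_imp_map by (auto simp: inc_homeo_def)
qed

lemma inc_homeo_continuous: "inc_homeo g \<Longrightarrow> continuous_on UNIV g"
  by (simp add: inc_homeo_iff strict_mono_surj_continuous)

text \<open>Since \<open>g (y - B) \<le> y \<le> g (y + B)\<close>, the intermediate value theorem
  reaches every \<open>y\<close>. This serves the intermediate stages of an isotopy, where only
  monotonicity is inherited directly.\<close>

lemma continuous_strict_mono_bounded_displacement:
  fixes g :: "real \<Rightarrow> real"
  assumes "strict_mono g" "continuous_on UNIV g" "\<And>x. \<bar>g x - x\<bar> \<le> B"
  shows "inc_homeo g"
proof -
  have "\<exists>x. y = g x" for y
  proof -
    have "g (y - B) \<le> y" "y \<le> g (y + B)" "0 \<le> B"
      using assms(3)[of "y - B"] assms(3)[of "y + B"] by auto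
    then show ?thesis
      using IVT'[of g "y - B" y "y + B"] continuous_on_subset[OF assms(2), of "{y - B..y + B}"]
      by auto
  qed
  then have "surj g" by (simp add: surj_def)
  then show ?thesis using assms(1) by (simp add: inc_homeo_iff)
qed

text \<open>
  On \<open>[0, p]\<close> the function \<open>F\<close> is rescaled affinely so that it gains exactly \<open>p\<close>,
  which keeps it increasing.
\<close>

lemma inc_homeo_periodic_approx:
  fixes F :: "real \<Rightarrow> real" and p e :: real
  assumes F: "inc_homeo F" and p: "p > 0"
    and e: "\<And>x j::int. \<bar>F (x + of_int j * p) - (F x + of_int j * p)\<bar> \<le> e"
  obtains G where "inc_homeo G" "\<And>x. G (x + p) = G x + p" "\<And>x. \<bar>G x - F x\<bar> \<le> 2 * e"
proof -
  have mono: "strict_mono F" and cont: "continuous_on UNIV F"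
    using F inc_homeo_continuous by (auto simp: inc_homeo_iff)
  define c where "c = p / (F p - F 0)"
  have gap: "F p - F 0 > 0" using mono p by (simp add: strict_mono_less)
  then have c: "c > 0" using p by (simp add: c_def)
  define G0 where "G0 y = F 0 + (F y - F 0) * c" for y
  define G where "G x = G0 (x - p * of_int \<lfloor>x / p\<rfloor>) + p * of_int \<lfloor>x / p\<rfloor>" for x
  have G0_mono: "strict_mono G0"
    using mono c by (simp add: G0_def strict_mono_def)
  have G0_p: "G0 p = G0 0 + p" using gap by (simp add: G0_def c_def)
  have G_eq: "G (r + p * of_int j) = G0 r + p * of_int j" if "0 \<le> r" "r < p" for r and j :: int
  proof -
    have "\<lfloor>(r + p * of_int j) / p\<rfloor> = j"
      using that p by (intro floor_unique) (auto simp: field_simps)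
    then show ?thesis by (simp add: G_def)
  qed
  have split: "\<exists>r j. 0 \<le> r \<and> r < p \<and> x = r + p * of_int (j::int)" for x
  proof (intro exI conjI)
    show "x = (x - p * of_int \<lfloor>x / p\<rfloor>) + p * of_int \<lfloor>x / p\<rfloor>" by simp
    show "0 \<le> x - p * of_int \<lfloor>x / p\<rfloor>"
      using of_int_floor_le[of "x / p"] p by (simp add: field_simps del: of_int_floor_le)
    show "x - p * of_int \<lfloor>x / p\<rfloor> < p"
      using floor_correct[of "x / p"] p by (simp add: field_simps)
  qed
  have G_mono: "strict_mono G"
  proof (rule strict_monoI)
    fix x y :: real assume "x < y"
    obtain r i where x: "0 \<le> r" "r < p" "x = r + p * of_int (i::int)" using split by blast
    obtain q j where y: "0 \<le> q" "q < p" "y = q + p * of_int (j::int)" using split by blast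
    have "p * of_int i < p * (of_int j + 1)" using \<open>x < y\<close> x y by (simp add: algebra_simps)
    then have "of_int i < (of_int (j + 1) :: real)" using p by simp
    then have "i \<le> j" by linarith
    show "G x < G y"
    proof (cases "i = j")
      case True
      then show ?thesis
        using x y \<open>x < y\<close> G0_mono by (simp add: G_eq strict_mono_less)
    next
      case False
      then have "of_int i + 1 \<le> (of_int j :: real)" using \<open>i \<le> j\<close> by linarith
      then have "p * (of_int i + 1) \<le> p * of_int j" using p by simp
      \<comment> \<open>Across cells, \<open>G0 r < G0 p = G0 0 + p \<le> G0 q + p\<close>, and the
        cell of \<open>y\<close> lies at least one \<open>p\<close> further.\<close>
      moreover have "G0 r < G0 p" "G0 0 \<le> G0 q"
        using x y G0_mono by (simp_all add: strict_mono_less strict_mono_less_eq)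
      ultimately show ?thesis using x y G0_p by (simp add: G_eq algebra_simps)
    qed
  qed
  have "surj G"
  proof (subst surj_def, rule allI)
    fix y
    obtain r j where y: "0 \<le> r" "r < p" "y - G0 0 = r + p * of_int (j::int)" using split by blast
    have "continuous_on {0..p} G0"
      unfolding G0_def using cont by (intro continuous_intros continuous_on_subset[OF cont]) auto
    then obtain q where q: "0 \<le> q" "q \<le> p" "G0 q = G0 0 + r"
      using IVT'[of G0 0 "G0 0 + r" p] y p G0_p by auto
    then have "q < p" using y G0_p by (cases "q = p") auto
    then have "G (q + p * of_int j) = y" using q y by (simp add: G_eq)
    then show "\<exists>x. y = G x" by metis
  qed
  have "G (x + p) = G x + p" for x
  proof -
    obtain r j where x: "0 \<le> r" "r < p" "x = r + p * of_int (j::int)" using split by blast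
    then have "x + p = r + p * of_int (j + 1)" by (simp add: algebra_simps)
    then show ?thesis using x by (simp only: G_eq)
  qed
  moreover have "\<bar>G x - F x\<bar> \<le> 2 * e" for x
  proof -
    obtain r j where x: "0 \<le> r" "r < p" "x = r + p * of_int (j::int)" using split by blast
    have 1: "0 \<le> F r - F 0" "F r - F 0 \<le> F p - F 0"
      using x mono by (simp_all add: strict_mono_less_eq)
    have "\<bar>F p - F 0 - p\<bar> \<le> e" using e[of 0 1] by (simp add: algebra_simps)
    \<comment> \<open>The rescaling error is a fraction in [0, 1] of the defect
      \<open>p - (F p - F 0)\<close>, which is at most \<open>e\<close>. Passing from
      \<open>r\<close> to \<open>x\<close> costs another \<open>e\<close>, whence the factor
      2.\<close>
    have "G0 r - F r = (F r - F 0) / (F p - F 0) * (p - (F p - F 0))"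
      using gap by (simp add: G0_def c_def field_simps)
    then have "\<bar>G0 r - F r\<bar> = (F r - F 0) / (F p - F 0) * \<bar>p - (F p - F 0)\<bar>"
      using 1 gap by (simp add: abs_mult)
    also have "\<dots> \<le> 1 * \<bar>p - (F p - F 0)\<bar>"
      using 1 gap by (intro mult_right_mono) auto
    also have "\<dots> \<le> e" using \<open>\<bar>F p - F 0 - p\<bar> \<le> e\<close> by simp
    finally have "\<bar>G0 r - F r\<bar> \<le> e" .
    moreover have "\<bar>F x - (F r + p * of_int j)\<bar> \<le> e"
      using e[of r j] x by (simp add: mult.commute)
    moreover have "G x = G0 r + p * of_int j" using x(3) G_eq[OF x(1,2), of j] by simp
    ultimately show ?thesis using x(3) by linarith
  qed
  moreover have "inc_homeo G" using G_mono \<open>surj G\<close> by (simp add: inc_homeo_iff)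
  ultimately show ?thesis using that by blast
qed

lemma int_multiple_period:
  fixes d :: "real \<Rightarrow> 'a"
  assumes "\<And>x. d (x + T) = d x"
  shows "d (x + of_int i * T) = d x"
proof (induction i rule: int_induct[where k = 0])
  case base then show ?case by simp
next
  case (step1 i)
  show ?case using assms[of "x + of_int i * T"] step1(2) by (simp add: algebra_simps)
next
  case (step2 i)
  show ?case using assms[of "x + of_int (i - 1) * T"] step2(2) by (simp add: algebra_simps)
qed

text \<open>
  An irrational period \<open>T\<close> would make \<open>n\<int> + T\<int>\<close>
  a dense group of almost periods, and hence the function constant.
\<close>

lemma integer_period:
  fixes d :: "real \<Rightarrow> real"
  assumes cont: "continuous_on UNIV d" and T: "T \<noteq> 0" and per: "\<And>x. d (x + T) = d x"
    and ap: "\<And>e. e > 0 \<Longrightarrow> \<exists>n\<ge>1::nat. \<forall>x. \<forall>j::int. \<bar>d (x + of_int j * of_nat n) - d x\<bar> \<le> e"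
  obtains m :: nat where "m \<ge> 1" "\<And>x. d (x + of_nat m) = d x"
proof (cases "T \<in> \<rat>")
  case True
  then obtain a b where ab: "b > 0" "T = of_int a / of_int b" by (rule Rats_cases')
  then have "a \<noteq> 0" using T by auto
  \<comment> \<open>Multiplying \<open>T = a / b\<close> by \<open>b\<close> gives the integer
    period \<open>a\<close>; the factor \<open>sgn a\<close> makes it positive.\<close>
  have "d (x + of_nat (nat \<bar>a\<bar>)) = d x" for x
  proof -
    have "of_nat (nat \<bar>a\<bar>) = of_int (sgn a * b) * T"
      using ab \<open>a \<noteq> 0\<close> by (simp add: sgn_if)
    then show ?thesis using int_multiple_period[of d T, OF per] by metis
  qed
  moreover have "nat \<bar>a\<bar> \<ge> 1" using \<open>a \<noteq> 0\<close> by linarith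
  ultimately show ?thesis using that by blast
next
  case False
  have const: "d x = d 0" for x
  proof (rule ccontr)
    assume ne: "d x \<noteq> d 0"
    \<comment> \<open>Two errors of size \<open>e\<close> will arise, one from continuity at
      \<open>x\<close> and one from an almost period, so a third of the gap suffices for a
      contradiction.\<close>
    define e where "e = \<bar>d x - d 0\<bar> / 3"
    have "e > 0" using ne by (simp add: e_def)
    obtain n :: nat where n: "n \<ge> 1" and dn: "\<And>y j::int. \<bar>d (y + of_int j * of_nat n) - d y\<bar> \<le> e"
      using ap[OF \<open>e > 0\<close>] by blast
    have "isCont d x" using cont by (simp add: continuous_on_eq_continuous_at)
    then obtain r where r: "r > 0" "\<And>y. \<bar>y - x\<bar> < r \<Longrightarrow> \<bar>d y - d x\<bar> < e"
      using \<open>e > 0\<close> unfolding continuous_at_eps_delta dist_real_def by metis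
    have "T / of_nat n \<notin> \<rat>"
    proof
      assume "T / of_nat n \<in> \<rat>"
      then have "T / of_nat n * of_nat n \<in> \<rat>" by (intro Rats_mult) auto
      then show False using False n by simp
    qed
    moreover have "r / of_nat n > 0" using r n by simp
    \<comment> \<open>Multiples of the irrational \<open>T / n\<close> are dense modulo 1. Rescaled
      by \<open>n\<close>, this puts some \<open>k T - h n\<close> within \<open>r\<close> of
      \<open>x\<close>.\<close>
    ultimately obtain h k :: int where "\<bar>of_int k * (T / of_nat n) - of_int h - x / of_nat n\<bar> < r / of_nat n"
      using sequence_of_fractional_parts_is_dense by metis
    then have "\<bar>of_int k * (T / of_nat n) - of_int h - x / of_nat n\<bar> * of_nat n < r"
      using n by (simp add: pos_less_divide_eq)
    moreover have "(of_int k * (T / of_nat n) - of_int h - x / of_nat n) * of_nat n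
        = (0 + of_int k * T) + of_int (- h) * of_nat n - x"
      using n by (simp add: left_diff_distrib)
    then have "\<bar>of_int k * (T / of_nat n) - of_int h - x / of_nat n\<bar> * of_nat n
        = \<bar>(0 + of_int k * T) + of_int (- h) * of_nat n - x\<bar>"
      by (metis abs_mult abs_of_nat)
    ultimately have "\<bar>d ((0 + of_int k * T) + of_int (- h) * of_nat n) - d x\<bar> < e" using r(2) by simp
    moreover have "\<bar>d ((0 + of_int k * T) + of_int (- h) * of_nat n) - d (0 + of_int k * T)\<bar> \<le> e"
      by (rule dn)
    moreover have "d (0 + of_int k * T) = d 0" by (rule int_multiple_period[of d T, OF per])
    ultimately have "\<bar>d x - d 0\<bar> < 2 * e" by linarith
    then show False using \<open>e > 0\<close> by (simp add: e_def)
  qed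
  have "d (x + of_nat 1) = d x" for x
    using const[of "x + of_nat 1"] const[of x] by (rule trans[OF _ sym])
  then show ?thesis using that[of 1] by simp
qed

section \<open>Quotients and inverse limits\<close>

lemma mem_cls: "x \<in> cls n x"
  unfolding cls_def by (rule CollectI, rule exI[of _ 0]) simp

lemma cls_eq_iff: "cls n x = cls n y \<longleftrightarrow> (\<exists>j. y = x + of_int j * of_nat n)"
proof
  assume "cls n x = cls n y"
  then have "y \<in> cls n x" using mem_cls by blast
  then show "\<exists>j. y = x + of_int j * of_nat n" by (auto simp: cls_def)
next
  assume "\<exists>j. y = x + of_int j * of_nat n"
  then obtain j where y: "y = x + of_int j * of_nat n" by blast
  have "x + of_int i * of_nat n = y + of_int (i - j) * of_nat n" for i
    unfolding y by (simp add: algebra_simps)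
  moreover have "y + of_int i * of_nat n = x + of_int (i + j) * of_nat n" for i
    unfolding y by (simp add: algebra_simps)
  ultimately show "cls n x = cls n y" unfolding cls_def by blast
qed

lemma cls_add: "(+) r ` cls n x = cls n (r + x)"
  by (auto simp: cls_def image_def add.assoc)

lemma bond_cls:
  assumes "m dvd n"
  shows "bond m (cls n x) = cls m x"
proof -
  obtain l where n: "n = m * l" using assms by (rule dvdE)
  have "cls m a = cls m x" if a: "a \<in> cls n x" for a
  proof -
    obtain j where "a = x + of_int j * of_nat n" using a by (auto simp: cls_def)
    then have "a = x + of_int (j * int l) * of_nat m"
      by (simp add: n mult.assoc of_nat_mult[symmetric] mult.commute[of m l] del: of_nat_mult)
    then show ?thesis using cls_eq_iff by metis
  qed
  then have "bond m (cls n x) = (\<Union>a\<in>cls n x. cls m x)" by (simp add: bond_def cong: SUP_cong)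
  also have "\<dots> = cls m x" using mem_cls[of x n] by blast
  finally show ?thesis .
qed

section \<open>The quotients \<real>/n\<int> as circles\<close>

lemma quotient_map_cls: "quotient_map euclidean (quot_top n) (cls n)"
  by (auto simp: quotient_map_def topspace_quot_top openin_quot_top vimage_def)

lemma continuous_map_from_quot:
  "continuous_map (quot_top n) Y g \<longleftrightarrow> continuous_map euclidean Y (\<lambda>x. g (cls n x))"
  using continuous_compose_quotient_map_eq[OF quotient_map_cls, of Y g] by (simp add: o_def)

text \<open>The standard identification of \<real>/n\<int> with the unit circle. The chosen
  representative is harmless for \<open>n \<ge> 1\<close>: changing it by a multiple of
  \<open>n\<close> changes the angle by a multiple of 2\<pi>.\<close>

definition coset_exp :: "nat \<Rightarrow> real set \<Rightarrow> complex" where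
  "coset_exp n A = cis (2 * pi * (SOME x. x \<in> A) / of_nat n)"

lemma cis_eq_cis_iff: "cis a = cis b \<longleftrightarrow> (\<exists>n::int. a = b + 2 * pi * of_int n)"
  using sin_cos_eq_iff[of a b] by (auto simp: complex_eq_iff)

lemma coset_exp_cls:
  assumes "n \<ge> 1"
  shows "coset_exp n (cls n x) = cis (2 * pi * x / of_nat n)"
proof -
  have "(SOME y. y \<in> cls n x) \<in> cls n x" using mem_cls by (rule someI)
  then obtain j where "(SOME y. y \<in> cls n x) = x + of_int j * of_nat n" by (auto simp: cls_def)
  then have "2 * pi * (SOME y. y \<in> cls n x) / of_nat n = 2 * pi * x / of_nat n + 2 * pi * of_int j"
    using assms by (simp add: field_simps)
  then show ?thesis unfolding coset_exp_def cis_eq_cis_iff by blast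
qed

lemma coset_exp_eq_iff:
  assumes "n \<ge> 1"
  shows "coset_exp n (cls n x) = coset_exp n (cls n y) \<longleftrightarrow> cls n x = cls n y"
proof
  assume "coset_exp n (cls n x) = coset_exp n (cls n y)"
  then have "cis (2 * pi * y / of_nat n) = cis (2 * pi * x / of_nat n)"
    using assms by (simp add: coset_exp_cls)
  then obtain j :: int where "2 * pi * y / of_nat n = 2 * pi * x / of_nat n + 2 * pi * of_int j"
    unfolding cis_eq_cis_iff by blast
  then have "2 * pi * y = 2 * pi * (x + of_int j * of_nat n)" using assms by (simp add: field_simps)
  then have "y = x + of_int j * of_nat n" by simp
  then show "cls n x = cls n y" by (auto simp: cls_eq_iff)
qed simp

lemma continuous_map_coset_exp:
  assumes "n \<ge> 1"
  shows "continuous_map (quot_top n) euclidean (coset_exp n)"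
  unfolding continuous_map_from_quot coset_exp_cls[OF assms]
  using assms by (simp, intro continuous_intros) auto

lemma inj_coset_exp: "n \<ge> 1 \<Longrightarrow> inj_on (coset_exp n) (topspace (quot_top n))"
  by (auto simp: inj_on_def topspace_quot_top coset_exp_eq_iff)

lemma compact_space_quot_top:
  assumes "n \<ge> 1"
  shows "compact_space (quot_top n :: real set topology)"
proof -
  have "compactin (quot_top n) (cls n ` {0..real n})"
    using quotient_imp_continuous_map[OF quotient_map_cls] by (rule image_compactin[rotated]) simp
  moreover have "cls n x \<in> cls n ` {0..real n}" for x :: real
  proof -
    define j where "j = \<lfloor>x / real n\<rfloor>"
    have "of_int j \<le> x / real n" "x / real n \<le> of_int j + 1"
      using floor_correct[of "x / real n"] by (simp_all add: j_def)
    then have "of_int j * real n \<le> x" "x \<le> (of_int j + 1) * real n"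
      using assms by (simp_all add: pos_le_divide_eq pos_divide_le_eq)
    then have "x + of_int (- j) * real n \<in> {0..real n}" by (simp add: algebra_simps)
    moreover have "cls n x = cls n (x + of_int (- j) * real n)" by (subst cls_eq_iff) blast
    ultimately show ?thesis by blast
  qed
  then have "cls n ` {0..real n} = range (cls n)" by blast
  ultimately show ?thesis by (simp add: compact_space_def topspace_quot_top)
qed

lemma Hausdorff_space_quot_top:
  "n \<ge> 1 \<Longrightarrow> Hausdorff_space (quot_top n :: real set topology)"
  by (rule Hausdorff_space_injective_preimage[OF _ continuous_map_coset_exp inj_coset_exp]) auto

text \<open>A continuous injection of a compact space into a Hausdorff space is an embedding, so
  continuity into the quotient can be tested after \<open>coset_exp\<close>.\<close>

lemma continuous_map_into_quot:
  assumes "n \<ge> 1"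
  shows "continuous_map X (quot_top n) g \<longleftrightarrow>
    g \<in> topspace X \<rightarrow> range (cls n) \<and> continuous_map X euclidean (\<lambda>x. coset_exp n (g x))"
proof
  assume g: "continuous_map X (quot_top n) g"
  then show "g \<in> topspace X \<rightarrow> range (cls n) \<and> continuous_map X euclidean (\<lambda>x. coset_exp n (g x))"
    using continuous_map_compose[OF g continuous_map_coset_exp[OF assms]]
    by (auto simp: continuous_map_def topspace_quot_top o_def)
next
  assume R: "g \<in> topspace X \<rightarrow> range (cls n) \<and> continuous_map X euclidean (\<lambda>x. coset_exp n (g x))"
  have "embedding_map (quot_top n) euclidean (coset_exp n)"
    using assms by (intro continuous_imp_embedding_map continuous_map_coset_exp
      compact_space_quot_top inj_coset_exp) auto
  then obtain h where "homeomorphic_maps (quot_top n)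
      (subtopology euclidean (coset_exp n ` topspace (quot_top n))) (coset_exp n) h"
    unfolding embedding_map_def homeomorphic_map_maps by blast
  then have h: "continuous_map (subtopology euclidean (coset_exp n ` topspace (quot_top n))) (quot_top n) h"
      "\<And>A. A \<in> topspace (quot_top n) \<Longrightarrow> h (coset_exp n A) = A"
    by (auto simp: homeomorphic_maps_def)
  have "continuous_map X (subtopology euclidean (coset_exp n ` topspace (quot_top n)))
      (\<lambda>x. coset_exp n (g x))"
    using R by (simp add: continuous_map_in_subtopology topspace_quot_top Pi_iff)
  then have "continuous_map X (quot_top n) (h \<circ> (\<lambda>x. coset_exp n (g x)))"
    using h(1) by (rule continuous_map_compose)
  then show "continuous_map X (quot_top n) g"
    by (rule continuous_map_eq) (use R h(2) in \<open>simp add: topspace_quot_top Pi_iff\<close>)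
qed

text \<open>One representative serves \<open>n\<close> and all its divisors, by the bonding maps. No
  single one need serve all \<open>n\<close>, since a point of the limit need not be of the form
  \<open>emb x\<close>.\<close>

lemma invlimD:
  assumes "s \<in> invlim" "n \<ge> 1"
  obtains x where "s n = cls n x" "\<And>m. m \<ge> 1 \<Longrightarrow> m dvd n \<Longrightarrow> s m = cls m x"
proof -
  have "s n \<in> range (cls n)" using assms by (auto simp: invlim_def)
  then obtain x where x: "s n = cls n x" by blast
  have "s m = cls m x" if "m \<ge> 1" "m dvd n" for m
  proof -
    have "bond m (s n) = s m" using assms that by (simp add: invlim_def)
    then show ?thesis using x bond_cls[OF that(2)] by metis
  qed
  then show ?thesis using x that by blast
qed

lemma invlimI:
  assumes "s \<in> extensional {1..}" "\<And>n. n \<ge> 1 \<Longrightarrow> s n \<in> range (cls n)"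
    "\<And>m n. m \<ge> 1 \<Longrightarrow> n \<ge> 1 \<Longrightarrow> m dvd n \<Longrightarrow> bond m (s n) = s m"
  shows "s \<in> invlim"
  using assms by (auto simp: invlim_def PiE_iff)

lemma invlim_eqI:
  assumes "s \<in> invlim" "t \<in> invlim" "\<And>n. n \<ge> 1 \<Longrightarrow> s n = t n"
  shows "s = t"
  using assms by (intro PiE_ext[of s "{1..}" "\<lambda>n. range (cls n)" t]) (auto simp: invlim_def)

section \<open>Topology of the inverse limits\<close>

lemma topspace_invlim_top: "topspace invlim_top = invlim"
  by (auto simp only: invlim_top_def topspace_subtopology topspace_product_topology
    topspace_quot_top invlim_def o_def)

lemma continuous_map_into_invlim:
  "continuous_map X invlim_top g \<longleftrightarrow>
     g \<in> topspace X \<rightarrow> invlim \<and> (\<forall>n\<ge>1. continuous_map X (quot_top n) (\<lambda>x. g x n))"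
  unfolding invlim_top_def continuous_map_in_subtopology continuous_map_componentwise
  by (auto simp: invlim_def PiE_iff)

lemma continuous_map_invlim_coord:
  assumes "n \<ge> 1"
  shows "continuous_map invlim_top (quot_top n) (\<lambda>s. s n)"
  using continuous_map_into_invlim[THEN iffD1, OF continuous_map_id[unfolded id_def]] assms by blast

text \<open>Each compatibility condition equates two continuous maps into a Hausdorff quotient and
  is therefore closed. The solenoid is thus closed in a product of circles, compact by
  Tychonoff.\<close>

lemma compact_space_solenoid: "compact_space solenoid_top"
proof -
  define P where "P = product_topology (quot_top :: nat \<Rightarrow> real set topology) {1..}"
  have P: "compact_space P"
    by (auto simp: P_def compact_space_product_topology compact_space_quot_top)
  define E where "E m n = {s \<in> topspace P. bond m (s n) = s m}" for m n
  have "closedin P (E m n)" if "1 \<le> m" "1 \<le> n" "m dvd n" for m n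
    unfolding E_def
  proof (rule closedin_continuous_maps_eq[OF Hausdorff_space_quot_top[OF that(1)]])
    show m: "continuous_map P (quot_top m) (\<lambda>s. s m)"
      unfolding P_def using that by (intro continuous_map_product_projection) simp
    have "continuous_map (quot_top n) (quot_top m) (bond m :: real set \<Rightarrow> real set)"
      unfolding continuous_map_from_quot bond_cls[OF that(3)]
      by (rule quotient_imp_continuous_map[OF quotient_map_cls])
    moreover have "continuous_map P (quot_top n) (\<lambda>s. s n)"
      unfolding P_def using that by (intro continuous_map_product_projection) simp
    ultimately show "continuous_map P (quot_top m) (\<lambda>s. bond m (s n))"
      using continuous_map_compose unfolding o_def by metis
  qed
  then have "closedin P (\<Inter>(m, n)\<in>{(m, n). 1 \<le> m \<and> 1 \<le> n \<and> m dvd n}. E m n)"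
    by (intro closedin_INT) auto
  moreover have "(\<Inter>(m, n)\<in>{(m, n). 1 \<le> m \<and> 1 \<le> n \<and> m dvd n}. E m n) = solenoid"
    by (auto simp: E_def P_def invlim_def topspace_quot_top)
  ultimately have "compactin P solenoid" using P closedin_compact_space by metis
  then show ?thesis unfolding P_def invlim_top_def by (rule compact_space_subtopology)
qed

lemma Hausdorff_space_solenoid: "Hausdorff_space solenoid_top"
  unfolding invlim_top_def
  by (intro Hausdorff_space_subtopology)
    (auto simp: Hausdorff_space_product_topology Hausdorff_space_quot_top)

section \<open>Shifts and leaves of the solenoid\<close>

text \<open>A character of the group: under the identification of the dual of the solenoid with the
  rationals it corresponds to 1/n.\<close>

definition sol_char :: "nat \<Rightarrow> sol \<Rightarrow> complex" where
  "sol_char n s = coset_exp n (s n)"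

text \<open>The flow of \<real> by translation, whose orbits are the leaves. Displacements of
  homeomorphisms are measured along it.\<close>

definition sol_shift :: "real \<Rightarrow> sol \<Rightarrow> sol" where
  "sol_shift r s = (\<lambda>n\<in>{1..}. (+) r ` s n)"

lemma sol_char_eq: "n \<ge> 1 \<Longrightarrow> s n = cls n x \<Longrightarrow> sol_char n s = cis (2 * pi * x / of_nat n)"
  by (simp add: sol_char_def coset_exp_cls)

lemma norm_sol_char [simp]: "norm (sol_char n s) = 1"
  by (simp add: sol_char_def coset_exp_def)

lemma sol_char_nonzero [simp]: "sol_char n s \<noteq> 0"
  using norm_sol_char[of n s] by (metis norm_zero zero_neq_one)

lemma continuous_map_into_solenoid:
  "continuous_map X solenoid_top g \<longleftrightarrow>
     g \<in> topspace X \<rightarrow> solenoid \<and> (\<forall>n\<ge>1. continuous_map X euclidean (\<lambda>x. sol_char n (g x)))"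
proof -
  have "(\<lambda>x. g x n) \<in> topspace X \<rightarrow> range (cls n)" if "g \<in> topspace X \<rightarrow> solenoid" "n \<ge> 1" for n
    using that by (auto simp: Pi_iff intro: invlimD)
  then show ?thesis
    unfolding continuous_map_into_invlim sol_char_def by (auto simp: continuous_map_into_quot)
qed

lemma continuous_map_sol_char: "n \<ge> 1 \<Longrightarrow> continuous_map solenoid_top euclidean (sol_char n)"
  using continuous_map_into_solenoid[THEN iffD1, OF continuous_map_id[unfolded id_def]] by simp

text \<open>Each coordinate is determined by its character. Identities in the solenoid, such as the
  flow law, thereby become identities between exponentials.\<close>

lemma sol_char_inject:
  assumes "s \<in> solenoid" "t \<in> solenoid" "\<And>n. n \<ge> 1 \<Longrightarrow> sol_char n s = sol_char n t"
  shows "s = t"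
proof (rule invlim_eqI[OF assms(1,2)])
  fix n :: nat assume n: "n \<ge> 1"
  obtain x where x: "s n = cls n x" using assms(1) n by (rule invlimD)
  obtain y where y: "t n = cls n y" using assms(2) n by (rule invlimD)
  show "s n = t n"
    using assms(3)[OF n] by (simp add: x y sol_char_def coset_exp_eq_iff[OF n])
qed

text \<open>The number exp (2\<pi>ix/n) is an \<open>n\<close>-th root of exp (2\<pi>ix). Control of
  coordinate 1 thus determines coordinate \<open>n\<close> up to a root of unity.\<close>

lemma sol_char_power:
  assumes "s \<in> solenoid" "n \<ge> 1"
  shows "sol_char n s ^ n = sol_char 1 s"
proof -
  obtain x where x: "s n = cls n x" "s 1 = cls 1 x"
    using assms by (metis invlimD le_refl one_dvd)
  then show ?thesis
    using assms sol_char_eq[of n s x] sol_char_eq[of 1 s x] Complex.DeMoivre[of "2 * pi * x / of_nat n" n]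
    by simp
qed

lemma sol_shift_cls: "n \<ge> 1 \<Longrightarrow> s n = cls n x \<Longrightarrow> sol_shift r s n = cls n (r + x)"
  by (simp add: sol_shift_def cls_add)

lemma sol_shift_in [simp]:
  assumes s: "s \<in> solenoid"
  shows "sol_shift r s \<in> solenoid"
proof (rule invlimI)
  show "sol_shift r s \<in> extensional {1..}" by (simp add: sol_shift_def)
  fix n :: nat assume n: "n \<ge> 1"
  obtain x where x: "s n = cls n x" "\<And>m. m \<ge> 1 \<Longrightarrow> m dvd n \<Longrightarrow> s m = cls m x"
    using invlimD[OF s n] by metis
  show "sol_shift r s n \<in> range (cls n)" using sol_shift_cls[of n s x r, OF n x(1)] by simp
  fix m :: nat assume m: "m \<ge> 1" "m dvd n"
  show "bond m (sol_shift r s n) = sol_shift r s m"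
    using sol_shift_cls[of n s x r, OF n x(1)] sol_shift_cls[of m s x r, OF m(1) x(2)[OF m]] m
    by (simp add: bond_cls)
qed

lemma sol_char_shift:
  assumes "s \<in> solenoid" "n \<ge> 1"
  shows "sol_char n (sol_shift r s) = cis (2 * pi * r / of_nat n) * sol_char n s"
proof -
  obtain x where x: "s n = cls n x" using assms by (rule invlimD)
  have "sol_char n (sol_shift r s) = cis (2 * pi * (r + x) / of_nat n)"
    by (rule sol_char_eq[where s = "sol_shift r s", OF assms(2) sol_shift_cls[where s = s, OF assms(2) x]])
  also have "\<dots> = cis (2 * pi * r / of_nat n) * cis (2 * pi * x / of_nat n)"
    by (simp add: cis_mult add_divide_distrib distrib_left)
  finally show ?thesis using sol_char_eq[where s = s, OF assms(2) x] by simp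
qed

lemma continuous_map_sol_shift:
  assumes r: "continuous_map X euclideanreal r" and g: "continuous_map X solenoid_top g"
  shows "continuous_map X solenoid_top (\<lambda>x. sol_shift (r x) (g x))"
  unfolding continuous_map_into_solenoid
proof (intro conjI allI impI)
  have g': "g \<in> topspace X \<rightarrow> solenoid" using g by (simp add: continuous_map_into_solenoid)
  then show "(\<lambda>x. sol_shift (r x) (g x)) \<in> topspace X \<rightarrow> solenoid" by (simp add: Pi_iff)
  fix n :: nat assume n: "n \<ge> 1"
  have "continuous_map X euclidean (\<lambda>x. cis (2 * pi * r x / of_nat n))"
  proof -
    have "continuous_map euclideanreal euclidean (\<lambda>x. cis (2 * pi * x / of_nat n))"
      using n by (simp, intro continuous_intros) auto
    from continuous_map_compose[OF r this] show ?thesis by (simp add: o_def)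
  qed
  moreover have "continuous_map X euclidean (\<lambda>x. sol_char n (g x))"
    using g n by (simp add: continuous_map_into_solenoid)
  ultimately have "continuous_map X euclidean (\<lambda>x. cis (2 * pi * r x / of_nat n) * sol_char n (g x))"
    by (simp add: continuous_map_atin tendsto_mult)
  then show "continuous_map X euclidean (\<lambda>x. sol_char n (sol_shift (r x) (g x)))"
    by (rule continuous_map_eq) (use g' n in \<open>auto simp: sol_char_shift Pi_iff\<close>)
qed

lemma sol_shift_0 [simp]: "s \<in> solenoid \<Longrightarrow> sol_shift 0 s = s"
  by (rule sol_char_inject) (auto simp: sol_char_shift)

lemma sol_shift_shift [simp]: "s \<in> solenoid \<Longrightarrow> sol_shift r (sol_shift q s) = sol_shift (r + q) s"
  by (rule sol_char_inject)
    (auto simp: sol_char_shift cis_mult add_divide_distrib distrib_left simp flip: mult.assoc)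

section \<open>The projection from \<real> \<times> \<open>Zhat\<close> and its leaves\<close>

lemma sol_proj_cls:
  assumes "n \<ge> 1" "k n = cls n a"
  shows "sol_proj x k n = cls n (x + of_int a)"
proof -
  have "sol_proj x k n = (\<lambda>j. x + of_int j) ` cls n a" using assms by (simp add: sol_proj_def)
  also have "\<dots> = cls n (x + of_int a)"
    by (force simp: cls_def image_def add.assoc)
  finally show ?thesis .
qed

lemma sol_proj_in [simp]:
  assumes k: "k \<in> Zhat"
  shows "sol_proj x k \<in> solenoid"
proof (rule invlimI)
  show "sol_proj x k \<in> extensional {1..}" by (simp add: sol_proj_def)
  fix n :: nat assume n: "n \<ge> 1"
  obtain a where a: "k n = cls n a" "\<And>m. m \<ge> 1 \<Longrightarrow> m dvd n \<Longrightarrow> k m = cls m a"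
    using invlimD[OF k n] by metis
  show "sol_proj x k n \<in> range (cls n)" using sol_proj_cls[of n k a x, OF n a(1)] by simp
  fix m :: nat assume m: "m \<ge> 1" "m dvd n"
  show "bond m (sol_proj x k n) = sol_proj x k m"
    using sol_proj_cls[of n k a x, OF n a(1)] sol_proj_cls[of m k a x, OF m(1) a(2)[OF m]] m
    by (simp add: bond_cls)
qed

lemma sol_shift_sol_proj [simp]: "sol_shift r (sol_proj x k) = sol_proj (r + x) k"
  by (rule ext) (simp add: sol_shift_def sol_proj_def image_image add.assoc)

text \<open>A real \<open>x\<close> representing coordinate 1 differs from some representative of
  every other coordinate by an integer. Collecting all such integers in \<open>k n\<close> avoids
  choices, so that compatibility is inherited from \<open>s\<close>.\<close>

lemma sol_proj_surj:
  assumes s: "s \<in> solenoid"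
  obtains x k where "k \<in> Zhat" "s = sol_proj x k"
proof -
  obtain x where x: "s 1 = cls 1 x" using s by (rule invlimD[of _ 1]) auto
  have lift: "\<exists>a::int. \<forall>m\<ge>1. m dvd n \<longrightarrow> s m = cls m (x + of_int a)" if n: "n \<ge> 1" for n
  proof -
    obtain y where y: "\<And>m. m \<ge> 1 \<Longrightarrow> m dvd n \<Longrightarrow> s m = cls m y" using invlimD[OF s n] by metis
    then have "cls 1 x = cls 1 y" using x by simp
    then obtain j :: int where "y = x + of_int j" by (auto simp: cls_eq_iff)
    then show ?thesis using y by blast
  qed
  define k where "k = (\<lambda>n\<in>{1..}. {j::int. x + of_int j \<in> s n})"
  have k: "k m = cls m a" if "m \<ge> 1" "s m = cls m (x + of_int a)" for m a
  proof -
    have "x + real_of_int j = x + of_int a + of_int i * of_nat m \<longleftrightarrow> j = a + i * int m" for i j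
    proof -
      have "x + of_int a + of_int i * of_nat m = x + real_of_int (a + i * int m)" by simp
      then show ?thesis by (metis add_left_cancel of_int_eq_iff)
    qed
    then show ?thesis using that by (auto simp: k_def cls_def)
  qed
  have "k \<in> Zhat"
  proof (rule invlimI)
    show "k \<in> extensional {1..}" by (simp add: k_def)
    fix n :: nat assume n: "n \<ge> 1"
    obtain a where a: "\<And>m. m \<ge> 1 \<Longrightarrow> m dvd n \<Longrightarrow> s m = cls m (x + of_int a)" using lift[OF n] by blast
    show "k n \<in> range (cls n)" using k[OF n a] n by simp
    fix m :: nat assume m: "m \<ge> 1" "m dvd n"
    show "bond m (k n) = k m" using k[OF n a] k[OF m(1) a] m n by (simp add: bond_cls)
  qed
  moreover have "s = sol_proj x k"
  proof (rule invlim_eqI[OF s sol_proj_in[OF \<open>k \<in> Zhat\<close>]])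
    fix n :: nat assume n: "n \<ge> 1"
    obtain a where a: "\<And>m. m \<ge> 1 \<Longrightarrow> m dvd n \<Longrightarrow> s m = cls m (x + of_int a)" using lift[OF n] by blast
    show "s n = sol_proj x k n"
      using sol_proj_cls[where k = k, OF n k[OF n a]] a[OF n] n by simp
  qed
  ultimately show ?thesis using that by blast
qed

text \<open>The projection is the flow applied to \<open>sol_proj 0\<close>. On coordinates the
  latter is the inclusion of \<int>/n\<int> in \<real>/n\<int>, continuous because \<int> is
  discrete.\<close>

lemma continuous_map_sol_proj:
  "continuous_map (prod_topology euclidean Zhat_top) solenoid_top (\<lambda>(x, k). sol_proj x k)"
proof -
  have "continuous_map Zhat_top solenoid_top (sol_proj 0)"
    unfolding continuous_map_into_invlim
  proof (intro conjI allI impI)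
    show "sol_proj 0 \<in> topspace Zhat_top \<rightarrow> solenoid" by (auto simp: topspace_invlim_top)
    fix n :: nat assume n: "n \<ge> 1"
    define q where "q A = real_of_int ` A" for A
    have q: "sol_proj 0 k n = q (k n)" for k using n by (simp add: sol_proj_def q_def)
    have "q (cls n a) = cls n (of_int a)" for a
      by (force simp: q_def cls_def image_def)
    then have "continuous_map (quot_top n) (quot_top n) q"
      unfolding continuous_map_from_quot by (auto simp: continuous_map_def open_discrete topspace_quot_top)
    from continuous_map_compose[OF continuous_map_invlim_coord[OF n] this]
    show "continuous_map Zhat_top (quot_top n) (\<lambda>k. sol_proj 0 k n)"
      unfolding q by (simp add: o_def)
  qed
  from continuous_map_compose[OF continuous_map_snd this]
  have "continuous_map (prod_topology euclidean Zhat_top) solenoid_top (\<lambda>z. sol_proj 0 (snd z))"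
    by (simp add: o_def)
  then have "continuous_map (prod_topology euclidean Zhat_top) solenoid_top
      (\<lambda>z. sol_shift (fst z) (sol_proj 0 (snd z)))"
    by (intro continuous_map_sol_shift continuous_map_fst)
  then show ?thesis by (simp add: case_prod_beta')
qed

section \<open>Differences in the limits and fibres of the projection\<close>

lemma cls_diff: "{a - b | a b. a \<in> cls n x \<and> b \<in> cls n y} = cls n (x - y)"
proof (intro equalityI subsetI)
  fix z assume "z \<in> {a - b | a b. a \<in> cls n x \<and> b \<in> cls n y}"
  then obtain i j where "z = (x + of_int i * of_nat n) - (y + of_int j * of_nat n)"
    by (auto simp: cls_def)
  then have "z = (x - y) + of_int (i - j) * of_nat n" by (simp add: algebra_simps)
  then show "z \<in> cls n (x - y)" unfolding cls_def by blast
next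
  fix z assume "z \<in> cls n (x - y)"
  then obtain j where "z = (x - y) + of_int j * of_nat n" by (auto simp: cls_def)
  then have "z = (x + of_int j * of_nat n) - y" by (simp add: algebra_simps)
  moreover have "x + of_int j * of_nat n \<in> cls n x" by (auto simp: cls_def)
  ultimately show "z \<in> {a - b | a b. a \<in> cls n x \<and> b \<in> cls n y}" using mem_cls[of y n] by blast
qed

lemma emb_in [simp]: "emb x \<in> invlim"
  by (rule invlimI) (auto simp: emb_def bond_cls)

lemma invlim_diff_cls:
  "n \<ge> 1 \<Longrightarrow> s n = cls n x \<Longrightarrow> t n = cls n y \<Longrightarrow> invlim_diff s t n = cls n (x - y)"
  by (simp add: invlim_diff_def cls_diff)

lemma invlim_diff_in [simp]:
  assumes s: "s \<in> invlim" and t: "t \<in> invlim"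
  shows "invlim_diff s t \<in> invlim"
proof (rule invlimI)
  show "invlim_diff s t \<in> extensional {1..}" by (simp add: invlim_diff_def)
  fix n :: nat assume n: "n \<ge> 1"
  obtain x where x: "s n = cls n x" "\<And>m. m \<ge> 1 \<Longrightarrow> m dvd n \<Longrightarrow> s m = cls m x"
    using invlimD[OF s n] by metis
  obtain y where y: "t n = cls n y" "\<And>m. m \<ge> 1 \<Longrightarrow> m dvd n \<Longrightarrow> t m = cls m y"
    using invlimD[OF t n] by metis
  show "invlim_diff s t n \<in> range (cls n)" using invlim_diff_cls[where s = s and t = t, OF n x(1) y(1)] by simp
  fix m :: nat assume m: "m \<ge> 1" "m dvd n"
  show "bond m (invlim_diff s t n) = invlim_diff s t m"
    using invlim_diff_cls[where s = s and t = t, OF n x(1) y(1)]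
      invlim_diff_cls[where s = s and t = t, OF m(1) x(2)[OF m] y(2)[OF m]] m
    by (simp add: bond_cls)
qed

lemma emb_cls: "n \<ge> 1 \<Longrightarrow> emb x n = cls n x"
  by (simp add: emb_def)

lemma sol_proj_diff_emb:
  assumes k: "k \<in> Zhat"
  shows "sol_proj (x + of_int t) (invlim_diff k (emb t)) = sol_proj x k"
proof (rule invlim_eqI)
  show "sol_proj (x + of_int t) (invlim_diff k (emb t)) \<in> solenoid" using k by simp
  show "sol_proj x k \<in> solenoid" using k by simp
  fix n :: nat assume n: "n \<ge> 1"
  obtain a where a: "k n = cls n a" using k n by (rule invlimD)
  show "sol_proj (x + of_int t) (invlim_diff k (emb t)) n = sol_proj x k n"
    using sol_proj_cls[where k = k, OF n a]
      sol_proj_cls[where k = "invlim_diff k (emb t)", OF n invlim_diff_cls[where s = k and t = "emb t", OF n a emb_cls[OF n]]]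
    by simp
qed

text \<open>Coordinate 1 shows that \<open>y - x\<close> is an integer \<open>t\<close>. As
  \<open>y - x\<close> is one real number, the same \<open>t\<close> governs every coordinate and
  forces \<open>l\<close> to be \<open>k - t\<close>.\<close>

lemma sol_proj_eqD:
  assumes eq: "sol_proj x k = sol_proj y l" and k: "k \<in> Zhat" and l: "l \<in> Zhat"
  obtains t :: int where "y = x + of_int t" "l = invlim_diff k (emb t)"
proof -
  have coord: "\<exists>j::int. y + of_int b = x + of_int a + of_int j * of_nat n"
    if "n \<ge> 1" "k n = cls n a" "l n = cls n b" for n a b
  proof -
    have "cls n (x + of_int a) = cls n (y + of_int b)"
      using eq sol_proj_cls[where k = k, OF that(1,2)] sol_proj_cls[where k = l, OF that(1,3)] by metis
    then show ?thesis by (simp add: cls_eq_iff)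
  qed
  obtain a where a: "k 1 = cls 1 a" using k by (rule invlimD[of _ 1]) auto
  obtain b where b: "l 1 = cls 1 b" using l by (rule invlimD[of _ 1]) auto
  obtain j :: int where "y + of_int b = x + of_int a + of_int j * of_nat 1"
    using coord[OF _ a b] by auto
  then have y: "y = x + of_int (a + j - b)" by simp
  define t where "t = a + j - b"
  have "l = invlim_diff k (emb t)"
  proof (rule invlim_eqI[OF l invlim_diff_in[OF k emb_in]])
    fix n :: nat assume n: "n \<ge> 1"
    obtain a where a: "k n = cls n a" using k n by (rule invlimD)
    obtain b where b: "l n = cls n b" using l n by (rule invlimD)
    obtain j :: int where "y + of_int b = x + of_int a + of_int j * of_nat n"
      using coord[OF n a b] by auto
    then have "real_of_int b = of_int (a - t + j * int n)" using y by (simp add: t_def)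
    then have "b = a - t + of_int j * of_nat n" by (simp only: of_int_eq_iff) simp
    then have "cls n (a - t) = cls n b" by (auto simp: cls_eq_iff)
    then show "l n = invlim_diff k (emb t) n"
      using invlim_diff_cls[where s = k and t = "emb t", OF n a emb_cls[OF n]] b by simp
  qed
  then show ?thesis using that y unfolding t_def by blast
qed

lemma sol_proj_inject:
  assumes eq: "sol_proj x k = sol_proj y k" and k: "k \<in> Zhat"
  shows "x = y"
proof -
  obtain t :: int where t: "y = x + of_int t" "k = invlim_diff k (emb t)"
    using sol_proj_eqD[OF eq k k] by blast
  \<comment> \<open>Equality of \<open>k\<close> and \<open>k - t\<close> makes every modulus divide
    \<open>t\<close>; a modulus exceeding \<open>\<bar>t\<bar>\<close> leaves only
    \<open>t = 0\<close>.\<close>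
  define n where "n = nat \<bar>t\<bar> + 1"
  have n: "n \<ge> 1" by (simp add: n_def)
  obtain a where a: "k n = cls n a" using k n by (rule invlimD)
  have "cls n a = cls n (a - t)" using invlim_diff_cls[where s = k and t = "emb t", OF n a emb_cls[OF n]] t(2) a by metis
  then obtain j where "- t = j * int n" by (auto simp: cls_eq_iff)
  then have "int n dvd t" by (metis dvd_minus_iff dvd_triv_right)
  then have "t = 0" using zdvd_imp_le[of "int n" "\<bar>t\<bar>"] by (auto simp: n_def)
  then show ?thesis using t by simp
qed

text \<open>The base point cancels. Uniform closeness of two homeomorphisms therefore reduces to
  smallness of the difference of their real displacements.\<close>

lemma invlim_diff_sol_shift:
  assumes s: "s \<in> solenoid"
  shows "invlim_diff (sol_shift r s) (sol_shift q s) = emb (r - q)"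
proof (rule invlim_eqI)
  fix n :: nat assume n: "n \<ge> 1"
  obtain x where x: "s n = cls n x" using s n by (rule invlimD)
  show "invlim_diff (sol_shift r s) (sol_shift q s) n = emb (r - q) n"
    using invlim_diff_cls[where s = "sol_shift r s" and t = "sol_shift q s",
        OF n sol_shift_cls[where s = s, OF n x] sol_shift_cls[where s = s, OF n x]] n
    by (simp add: emb_cls)
qed (use s in auto)

lemma continuous_map_emb: "continuous_map euclideanreal solenoid_top emb"
proof -
  have "emb r = sol_shift r (emb 0)" for r
    using sol_shift_cls[of _ "emb 0" 0 r] by (intro invlim_eqI) (simp_all add: emb_cls)
  then have "emb = (\<lambda>r. sol_shift r (emb 0))" by (rule ext)
  moreover have "continuous_map euclideanreal solenoid_top (\<lambda>r. sol_shift r (emb 0))"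
    by (rule continuous_map_sol_shift) (simp_all add: topspace_invlim_top)
  ultimately show ?thesis by simp
qed

section \<open>Lifting isotopies\<close>

text \<open>The triples \<open>(t, u, s)\<close> at which \<open>g\<close> varies by at least
  \<open>e\<close> form a compact set. On it \<open>\<bar>t - u\<bar>\<close> has a compact range
  missing 0, hence is bounded away from 0, uniformly in \<open>s\<close>.\<close>

lemma uniformly_continuous_in_time:
  fixes g :: "real \<times> 'a \<Rightarrow> 'b::real_normed_vector"
  assumes X: "compact_space X" and e: "e > 0"
    and g: "continuous_map (prod_topology (top_of_set {0..1}) X) euclidean g"
  obtains N :: nat where "N \<ge> 1"
    "\<And>t u s. t \<in> {0..1} \<Longrightarrow> u \<in> {0..1} \<Longrightarrow> \<bar>t - u\<bar> \<le> 1 / of_nat N \<Longrightarrow> s \<in> topspace X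
      \<Longrightarrow> norm (g (t, s) - g (u, s)) < e"
proof -
  define I where "I = top_of_set {0..1::real}"
  define Y where "Y = prod_topology I (prod_topology I X)"
  have "compact_space I" by (simp add: I_def compact_space_subtopology)
  then have Y: "compact_space Y" using X by (simp add: Y_def compact_space_prod_topology)
  define B where "B = {z \<in> topspace Y.
    norm (g (fst z, snd (snd z)) - g (fst (snd z), snd (snd z))) \<in> {e..}}"
  have 1: "continuous_map Y I fst" unfolding Y_def by (rule continuous_map_fst)
  have s: "continuous_map Y (prod_topology I X) snd" unfolding Y_def by (rule continuous_map_snd)
  have 2: "continuous_map Y I (\<lambda>z. fst (snd z))"
    using continuous_map_compose[OF s continuous_map_fst] by (simp add: o_def)
  have 3: "continuous_map Y X (\<lambda>z. snd (snd z))"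
    using continuous_map_compose[OF s continuous_map_snd] by (simp add: o_def)
  have g1: "continuous_map Y euclidean (\<lambda>z. g (fst z, snd (snd z)))"
    using continuous_map_compose[OF continuous_map_pairedI[OF 1 3] g[folded I_def]] by (simp add: o_def)
  have g2: "continuous_map Y euclidean (\<lambda>z. g (fst (snd z), snd (snd z)))"
    using continuous_map_compose[OF continuous_map_pairedI[OF 2 3] g[folded I_def]] by (simp add: o_def)
  have "closedin Y B"
    unfolding B_def
  proof (rule closedin_continuous_map_preimage)
    show "continuous_map Y euclideanreal
        (\<lambda>z. norm (g (fst z, snd (snd z)) - g (fst (snd z), snd (snd z))))"
      using g1 g2 by (intro continuous_map_norm continuous_map_diff)
  qed simp
  then have "compactin Y B" using Y closedin_compact_space by blast
  moreover have "continuous_map Y euclideanreal (\<lambda>z. \<bar>fst z - fst (snd z)\<bar>)"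
    using 1 2 unfolding I_def
    by (intro continuous_map_real_abs continuous_map_diff) (auto dest: continuous_map_into_fulltopology)
  ultimately have "compactin euclideanreal ((\<lambda>z. \<bar>fst z - fst (snd z)\<bar>) ` B)"
    by (rule image_compactin)
  then have "open (- ((\<lambda>z. \<bar>fst z - fst (snd z)\<bar>) ` B))"
    by (simp add: compact_imp_closed open_Compl)
  moreover have "0 \<in> - ((\<lambda>z. \<bar>fst z - fst (snd z)\<bar>) ` B)"
    using e by (auto simp: B_def)
  ultimately obtain d where d: "d > 0" "ball 0 d \<subseteq> - ((\<lambda>z. \<bar>fst z - fst (snd z)\<bar>) ` B)"
    using open_contains_ball by metis
  obtain N where N: "inverse (of_nat (Suc N)) < d" using reals_Archimedean[OF d(1)] by blast
  show ?thesis
  proof (rule that[of "Suc N"])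
    fix t u :: real and s assume t: "t \<in> {0..1}" and u: "u \<in> {0..1}" and s: "s \<in> topspace X"
      and tu: "\<bar>t - u\<bar> \<le> 1 / of_nat (Suc N)"
    have "\<bar>t - u\<bar> \<in> ball 0 d" using tu N by (simp add: inverse_eq_divide)
    then have "\<bar>t - u\<bar> \<notin> (\<lambda>z. \<bar>fst z - fst (snd z)\<bar>) ` B" using d by blast
    then have "(t, u, s) \<notin> B" by force
    then show "norm (g (t, s) - g (u, s)) < e"
      using t u s by (auto simp: B_def Y_def I_def)
  qed simp
qed

lemma cis_Im_Ln: "norm w = 1 \<Longrightarrow> cis (Im (Ln w)) = w"
  using exp_eq_polar[of "Ln w"] exp_Ln[of w] by (cases "w = 0") auto

text \<open>
  The path \<open>t \<mapsto> H (t, s) - s\<close> is lifted from the circle \<open>\<real>/\<int>\<close> to \<open>\<real>\<close>, adding up small angles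
  along a uniform subdivision. At level \<open>n\<close> the lift is correct up to an \<open>n\<close>-th root of unity that
  depends continuously on \<open>t\<close>, hence exactly.
\<close>

lemma isotopy_lift:
  assumes H: "continuous_map (prod_topology (top_of_set {0..1::real}) solenoid_top) solenoid_top H"
    and H0: "\<And>s. s \<in> solenoid \<Longrightarrow> H (0, s) = s"
  obtains \<phi> where "continuous_map solenoid_top euclideanreal \<phi>"
    "\<And>s. s \<in> solenoid \<Longrightarrow> H (1, s) = sol_shift (\<phi> s) s"
proof -
  define P where "P = prod_topology (top_of_set {0..1::real}) solenoid_top"
  have topP: "topspace P = {0..1} \<times> solenoid" by (simp add: P_def topspace_invlim_top)
  have H_in: "H (t, s) \<in> solenoid" if "t \<in> {0..1}" "s \<in> solenoid" for t s
    using H that by (auto simp: continuous_map_def topspace_invlim_top)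
  have char_H: "continuous_map P euclidean (\<lambda>z. sol_char n (H z))" if "n \<ge> 1" for n
    using continuous_map_compose[OF H continuous_map_sol_char[OF that]] by (simp add: o_def P_def)
  have char_snd: "continuous_map P euclidean (\<lambda>z. sol_char n (snd z))" if "n \<ge> 1" for n
    using continuous_map_compose[OF continuous_map_snd continuous_map_sol_char[OF that]]
    by (simp add: o_def P_def)
  \<comment> \<open>Coordinate 1 of \<open>H (t, s) - s\<close>, seen on the unit circle.\<close>
  define c where "c z = sol_char 1 (H z) / sol_char 1 (snd z)" for z
  have c_cont: "continuous_map P euclidean c"
    using char_H[of 1] char_snd[of 1] unfolding c_def by (simp add: continuous_map_atin tendsto_divide)
  have norm_c: "norm (c z) = 1" for z by (simp add: c_def norm_divide)
  then have c_nz: "c z \<noteq> 0" for z by (metis norm_zero zero_neq_one)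
  obtain N :: nat where N: "N \<ge> 1"
    "\<And>t u s. t \<in> {0..1} \<Longrightarrow> u \<in> {0..1} \<Longrightarrow> \<bar>t - u\<bar> \<le> 1 / of_nat N \<Longrightarrow> s \<in> solenoid
      \<Longrightarrow> norm (c (t, s) - c (u, s)) < 1"
    using uniformly_continuous_in_time[OF compact_space_solenoid zero_less_one c_cont[unfolded P_def]]
    unfolding topspace_invlim_top by metis
  define q where "q i = real i / real N" for i
  have q: "q i \<in> {0..1}" if "i \<le> N" for i using that N(1) by (simp add: q_def)
  \<comment> \<open>Subdividing [0, t] instead of [0, 1] keeps the number of factors fixed while
    \<open>t\<close> varies, so that the sum of their angles is continuous in \<open>t\<close> as
    well.\<close>
  define w where "w i z = c (fst z * q (Suc i), snd z) / c (fst z * q i, snd z)" for i z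
  have norm_w: "norm (w i z) = 1" for i z by (simp add: w_def norm_divide norm_c)
  have w_right: "w i z \<notin> \<real>\<^sub>\<le>\<^sub>0" if i: "i < N" and z: "z \<in> topspace P" for i z
  proof -
    have t: "fst z \<in> {0..1}" "snd z \<in> solenoid" using z by (auto simp: topP)
    have "\<bar>fst z * q (Suc i) - fst z * q i\<bar> = fst z * (1 / of_nat N)"
      using t by (simp add: q_def abs_mult add_divide_distrib distrib_left)
    also have "\<dots> \<le> 1 * (1 / of_nat N)" using t by (intro mult_right_mono) auto
    finally have "norm (c (fst z * q (Suc i), snd z) - c (fst z * q i, snd z)) < 1"
      using t q[of i] q[of "Suc i"] i by (intro N(2)) (auto simp: mult_le_one)
    moreover have "w i z - 1 = (c (fst z * q (Suc i), snd z) - c (fst z * q i, snd z)) / c (fst z * q i, snd z)"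
      using c_nz by (simp add: w_def diff_divide_distrib)
    ultimately have "norm (w i z - 1) < 1" by (simp add: norm_divide norm_c)
    \<comment> \<open>The real part of \<open>w i z\<close> is positive, which keeps it off the
      branch cut of \<open>Ln\<close>.\<close>
    then have "\<bar>Re (w i z - 1)\<bar> < 1" using abs_Re_le_cmod le_less_trans by blast
    then show ?thesis by (auto simp: complex_nonpos_Reals_iff)
  qed
  have c_scale: "continuous_map P euclidean (\<lambda>z. c (fst z * q i, snd z))" if "i \<le> N" for i
  proof -
    have "continuous_map P euclideanreal (\<lambda>z. fst z * q i)"
      unfolding P_def using continuous_map_into_fulltopology[OF continuous_map_fst]
      by (intro continuous_map_real_mult) auto
    then have "continuous_map P (top_of_set {0..1}) (\<lambda>z. fst z * q i)"
      using q[OF that] by (auto simp: continuous_map_in_subtopology topP mult_le_one)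
    then have "continuous_map P P (\<lambda>z. (fst z * q i, snd z))"
      unfolding P_def by (intro continuous_map_pairedI continuous_map_snd)
    from continuous_map_compose[OF this c_cont] show ?thesis by (simp add: o_def)
  qed
  define \<psi> where "\<psi> z = (\<Sum>i<N. Im (Ln (w i z))) / (2 * pi)" for z
  have "continuous_map P euclideanreal (\<lambda>z. Im (Ln (w i z)))" if i: "i < N" for i
  proof -
    have "continuous_map P euclidean (w i)"
      unfolding w_def using c_scale[of i] c_scale[of "Suc i"] i c_nz
      by (simp add: continuous_map_atin tendsto_divide)
    then show ?thesis
      using w_right[OF i] by (auto simp: continuous_map_atin intro!: tendsto_Im tendsto_Ln)
  qed
  then have \<psi>_cont: "continuous_map P euclideanreal \<psi>"
    unfolding \<psi>_def by (auto simp: continuous_map_atin intro!: tendsto_sum tendsto_divide)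
  have prod: "cis (\<Sum>i<M. Im (Ln (w i z))) = c (fst z * q M, snd z) / c (0, snd z)" for M z
  proof (induction M)
    case 0 then show ?case using c_nz by (simp add: q_def)
  next
    case (Suc M)
    have "cis (\<Sum>i<Suc M. Im (Ln (w i z))) = cis (\<Sum>i<M. Im (Ln (w i z))) * w M z"
      by (simp add: cis_Im_Ln[OF norm_w] flip: cis_mult)
    then show ?case using Suc c_nz by (simp add: w_def)
  qed
  have c0: "c (0, s) = 1" if "s \<in> solenoid" for s using that by (simp add: c_def H0)
  have cis_\<psi>: "cis (2 * pi * \<psi> (t, s)) = c (t, s)" if "s \<in> solenoid" for t s
    using prod[where M = N and z = "(t, s)"] N(1) c0[OF that] by (simp add: \<psi>_def q_def)
  have \<psi>0: "\<psi> (0, s) = 0" if "s \<in> solenoid" for s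
    using c0[OF that] by (simp add: \<psi>_def w_def)
  have char_eq: "sol_char n (H (1, s)) = cis (2 * pi * \<psi> (1, s) / of_nat n) * sol_char n s"
    if n: "n \<ge> 1" and s: "s \<in> solenoid" for n s
  proof -
    define r where "r t = sol_char n (H (t, s)) / (cis (2 * pi * \<psi> (t, s) / of_nat n) * sol_char n s)" for t
    have path: "continuous_map (top_of_set {0..1}) P (\<lambda>t. (t, s))"
      unfolding P_def using s by (intro continuous_map_pairedI) (auto simp: topspace_invlim_top)
    have "continuous_on {0..1} (\<lambda>t. sol_char n (H (t, s)))" "continuous_on {0..1} (\<lambda>t. \<psi> (t, s))"
      using continuous_map_compose[OF path char_H[OF n]] continuous_map_compose[OF path \<psi>_cont]
      by (simp_all add: o_def)
    then have "continuous_on {0..1} r"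
      unfolding r_def using n by (intro continuous_intros) auto
    moreover have "r t ^ n = 1" if t: "t \<in> {0..1}" for t
    proof -
      have "cis (2 * pi * \<psi> (t, s) / of_nat n) ^ n = c (t, s)"
        using Complex.DeMoivre[of "2 * pi * \<psi> (t, s) / of_nat n" n] n cis_\<psi>[OF s] by simp
      then show ?thesis
        using sol_char_power[OF H_in[OF t s] n] sol_char_power[OF s n]
        by (simp add: r_def power_divide power_mult_distrib c_def)
    qed
    then have "finite (r ` {0..1})"
      using finite_subset[OF _ finite_roots_unity[OF n]] by blast
    ultimately have "r constant_on {0..1}"
      by (intro continuous_finite_range_constant) auto
    then have "r 1 = r 0" by (force simp: constant_on_def)
    also have "\<dots> = 1" using s by (simp add: r_def H0 \<psi>0)
    finally show ?thesis by (simp add: r_def)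
  qed
  show ?thesis
  proof (rule that[of "\<lambda>s. \<psi> (1, s)"])
    have "continuous_map solenoid_top P (\<lambda>s. (1, s))"
      unfolding P_def by (intro continuous_map_pairedI) (auto simp: continuous_map_id[unfolded id_def])
    from continuous_map_compose[OF this \<psi>_cont]
    show "continuous_map solenoid_top euclideanreal (\<lambda>s. \<psi> (1, s))" by (simp add: o_def)
    fix s :: sol assume s: "s \<in> solenoid"
    show "H (1, s) = sol_shift (\<psi> (1, s)) s"
      using s by (intro sol_char_inject H_in) (auto simp: sol_char_shift char_eq)
  qed
qed

section \<open>Homeomorphisms as displacements\<close>

text \<open>A single function on the solenoid packages all displacements. Since
  \<open>sol_proj\<close> is constant on orbits of \<int>, the equivariance required of a lift
  becomes automatic.\<close>

definition displaced_by :: "(sol \<Rightarrow> sol) \<Rightarrow> (sol \<Rightarrow> real) \<Rightarrow> bool" where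
  "displaced_by f \<phi> \<longleftrightarrow> continuous_map solenoid_top euclideanreal \<phi> \<and>
     (\<forall>s\<in>solenoid. f s = sol_shift (\<phi> s) s) \<and>
     (\<forall>k\<in>Zhat. inc_homeo (\<lambda>x. x + \<phi> (sol_proj x k)))"

lemma continuous_on_leaf:
  assumes \<phi>: "continuous_map solenoid_top euclideanreal \<phi>" and k: "k \<in> Zhat"
  shows "continuous_on UNIV (\<lambda>x. \<phi> (sol_proj x k))"
proof -
  have "continuous_map euclideanreal (prod_topology euclidean Zhat_top) (\<lambda>x. (x, k))"
    using k by (intro continuous_map_pairedI) (auto simp: topspace_invlim_top)
  from continuous_map_compose[OF continuous_map_compose[OF this continuous_map_sol_proj] \<phi>]
  show ?thesis by (simp add: o_def)
qed

lemma bounded_on_solenoid: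
  assumes \<phi>: "continuous_map solenoid_top euclideanreal \<phi>"
  obtains B where "\<And>s. s \<in> solenoid \<Longrightarrow> \<bar>\<phi> s\<bar> \<le> B"
proof -
  have "compactin solenoid_top solenoid"
    using compact_space_solenoid by (simp add: compact_space_def topspace_invlim_top)
  then have "compact (\<phi> ` solenoid)" using image_compactin[OF _ \<phi>] by simp
  from compact_imp_bounded[OF this] obtain B where "\<forall>y\<in>\<phi> ` solenoid. norm y \<le> B"
    unfolding bounded_iff by blast
  then show ?thesis using that[of B] by simp
qed

text \<open>The map preserves every leaf, so bijectivity can be checked leaf by leaf, where it holds
  by \<open>inc\<close>. Compactness then supplies continuity of the inverse.\<close>

lemma sol_shift_homeomorphic:
  assumes \<phi>: "continuous_map solenoid_top euclideanreal \<phi>"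
    and inc: "\<And>k. k \<in> Zhat \<Longrightarrow> inc_homeo (\<lambda>x. x + \<phi> (sol_proj x k))"
  shows "homeomorphic_map solenoid_top solenoid_top (\<lambda>s. sol_shift (\<phi> s) s)"
proof (rule continuous_imp_homeomorphic_map[OF _ compact_space_solenoid Hausdorff_space_solenoid])
  show "continuous_map solenoid_top solenoid_top (\<lambda>s. sol_shift (\<phi> s) s)"
    using \<phi> by (intro continuous_map_sol_shift continuous_map_id[unfolded id_def])
  show "inj_on (\<lambda>s. sol_shift (\<phi> s) s) (topspace solenoid_top)"
    unfolding topspace_invlim_top
  proof (rule inj_onI)
    fix s t assume s: "s \<in> solenoid" and t: "t \<in> solenoid"
      and eq: "sol_shift (\<phi> s) s = sol_shift (\<phi> t) t"
    obtain x k where k: "k \<in> Zhat" "s = sol_proj x k" using sol_proj_surj[OF s] by metis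
    obtain y l where l: "l \<in> Zhat" "t = sol_proj y l" using sol_proj_surj[OF t] by metis
    have "sol_proj (y + \<phi> t) l = sol_proj (x + \<phi> s) k" using eq k l by (simp add: add.commute)
    then obtain i :: int where i: "x + \<phi> s = y + \<phi> t + of_int i" "k = invlim_diff l (emb i)"
      using k l sol_proj_eqD by metis
    \<comment> \<open>Equal images lie on one leaf. Rewriting \<open>t\<close> with the parameter
      \<open>k\<close> makes the injectivity of that leaf's map applicable.\<close>
    have t_eq: "t = sol_proj (y + of_int i) k"
      using sol_proj_diff_emb[OF l(1)] by (simp add: i l)
    have "x + \<phi> (sol_proj x k) = (y + of_int i) + \<phi> (sol_proj (y + of_int i) k)"
      using i(1) by (simp add: k(2)[symmetric] t_eq[symmetric])
    then have "x = y + of_int i"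
      using strict_mono_eq[of "\<lambda>x. x + \<phi> (sol_proj x k)" x "y + of_int i"] inc[OF k(1)]
      by (simp add: inc_homeo_iff)
    then show "s = t" using k(2) t_eq by simp
  qed
  show "(\<lambda>s. sol_shift (\<phi> s) s) ` topspace solenoid_top = topspace solenoid_top"
    unfolding topspace_invlim_top
  proof (intro equalityI subsetI)
    fix t :: sol assume "t \<in> solenoid"
    then obtain y k where k: "k \<in> Zhat" "t = sol_proj y k" by (rule sol_proj_surj)
    obtain x where "y = x + \<phi> (sol_proj x k)"
      using inc[OF k(1)] unfolding inc_homeo_iff surj_def by blast
    then have "t = sol_shift (\<phi> (sol_proj x k)) (sol_proj x k)" using k by (simp add: add.commute)
    then show "t \<in> (\<lambda>s. sol_shift (\<phi> s) s) ` solenoid" using k(1) sol_proj_in by blast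
  qed auto
qed

text \<open>Scaling \<phi> by \<open>t\<close> in [0, 1] gives the isotopy: on each leaf the stage
  at time \<open>t\<close> is a convex combination of the identity and an increasing
  homeomorphism.\<close>

lemma displaced_by_Homeo_plus:
  assumes ext: "f \<in> extensional solenoid" and f: "displaced_by f \<phi>"
  shows "f \<in> Homeo_plus"
proof -
  have \<phi>: "continuous_map solenoid_top euclideanreal \<phi>"
    and f_eq: "\<And>s. s \<in> solenoid \<Longrightarrow> f s = sol_shift (\<phi> s) s"
    and inc: "\<And>k. k \<in> Zhat \<Longrightarrow> inc_homeo (\<lambda>x. x + \<phi> (sol_proj x k))"
    using f by (auto simp: displaced_by_def)
  have "homeomorphic_map solenoid_top solenoid_top f"
    using sol_shift_homeomorphic[OF \<phi> inc]
    by (rule homeomorphic_map_eq) (simp_all add: f_eq topspace_invlim_top)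
  moreover have "leaf_orientation_preserving f"
    unfolding leaf_orientation_preserving_def
  proof
    fix k :: zhat assume k: "k \<in> Zhat"
    have "f (sol_proj x k) = sol_proj (x + \<phi> (sol_proj x k)) k" for x
      using k by (simp add: f_eq add.commute)
    then show "\<exists>k'\<in>Zhat. \<exists>g. inc_homeo g \<and> (\<forall>x. f (sol_proj x k) = sol_proj (g x) k')"
      using k inc by blast
  qed
  moreover have "isotopic_to_id f"
    unfolding isotopic_to_id_def
  proof (intro exI conjI ballI)
    let ?H = "\<lambda>z. sol_shift (fst z * \<phi> (snd z)) (snd z)"
    have "continuous_map (prod_topology (top_of_set {0..1::real}) solenoid_top) euclideanreal fst"
      using continuous_map_into_fulltopology[OF continuous_map_fst] .
    moreover have "continuous_map (prod_topology (top_of_set {0..1::real}) solenoid_top) euclideanreal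
        (\<lambda>z. \<phi> (snd z))"
      using continuous_map_compose[OF continuous_map_snd \<phi>] by (simp add: o_def)
    ultimately show "continuous_map (prod_topology (top_of_set {0..1::real}) solenoid_top) solenoid_top ?H"
      by (intro continuous_map_sol_shift continuous_map_real_mult continuous_map_snd)
    fix t :: real assume t: "t \<in> {0..1}"
    have "homeomorphic_map solenoid_top solenoid_top (\<lambda>s. sol_shift (t * \<phi> s) s)"
    proof (rule sol_shift_homeomorphic)
      show t\<phi>: "continuous_map solenoid_top euclideanreal (\<lambda>s. t * \<phi> s)"
        using \<phi> by (rule continuous_map_real_mult_left)
      fix k :: zhat assume k: "k \<in> Zhat"
      obtain B where B: "\<And>s. s \<in> solenoid \<Longrightarrow> \<bar>t * \<phi> s\<bar> \<le> B" using bounded_on_solenoid[OF t\<phi>] by metis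
      show "inc_homeo (\<lambda>x. x + t * \<phi> (sol_proj x k))"
      proof (rule continuous_strict_mono_bounded_displacement)
        show "strict_mono (\<lambda>x. x + t * \<phi> (sol_proj x k))"
        proof (rule strict_monoI)
          fix x y :: real assume xy: "x < y"
          then have less: "x + \<phi> (sol_proj x k) < y + \<phi> (sol_proj y k)"
            using inc[OF k] by (auto simp: inc_homeo_iff strict_mono_def)
          have conv: "z + t * \<phi> (sol_proj z k) = (1 - t) * z + t * (z + \<phi> (sol_proj z k))" for z
            by (simp add: algebra_simps)
          show "x + t * \<phi> (sol_proj x k) < y + t * \<phi> (sol_proj y k)"
          proof (cases "t = 0")
            case False
            then have "t * (x + \<phi> (sol_proj x k)) < t * (y + \<phi> (sol_proj y k))"
              using t less by (intro mult_strict_left_mono) auto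
            moreover have "(1 - t) * x \<le> (1 - t) * y" using t xy by (intro mult_left_mono) auto
            ultimately show ?thesis unfolding conv by linarith
          qed (use xy in simp)
        qed
        show "continuous_on UNIV (\<lambda>x. x + t * \<phi> (sol_proj x k))"
          using continuous_on_leaf[OF t\<phi> k] by (intro continuous_on_add continuous_on_id)
        show "\<bar>x + t * \<phi> (sol_proj x k) - x\<bar> \<le> B" for x
          using B[OF sol_proj_in[OF k]] by simp
      qed
    qed
    then show "homeomorphic_map solenoid_top solenoid_top (\<lambda>s. ?H (t, s))" by simp
  qed (auto simp: f_eq)
  ultimately show ?thesis using ext by (simp add: Homeo_plus_def)
qed

text \<open>The isotopy yields \<phi>, and orientation yields an increasing homeomorphism
  \<open>g\<close> between leaf parameters. Both describe \<open>f\<close> on the same leaf, so they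
  differ by a continuous integer-valued function, that is, by a constant.\<close>

lemma Homeo_plus_displaced_by:
  assumes f: "f \<in> Homeo_plus"
  obtains \<phi> where "displaced_by f \<phi>"
proof -
  obtain H where H: "continuous_map (prod_topology (top_of_set {0..1::real}) solenoid_top) solenoid_top H"
      "\<And>s. s \<in> solenoid \<Longrightarrow> H (0, s) = s" "\<And>s. s \<in> solenoid \<Longrightarrow> H (1, s) = f s"
    using f unfolding Homeo_plus_def isotopic_to_id_def by blast
  obtain \<phi> where \<phi>: "continuous_map solenoid_top euclideanreal \<phi>"
      "\<And>s. s \<in> solenoid \<Longrightarrow> f s = sol_shift (\<phi> s) s"
    using isotopy_lift[OF H(1,2)] H(3) by metis
  have "inc_homeo (\<lambda>x. x + \<phi> (sol_proj x k))" if k: "k \<in> Zhat" for k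
  proof -
    obtain l g where l: "l \<in> Zhat" and g: "inc_homeo g" and fg: "\<And>x. f (sol_proj x k) = sol_proj (g x) l"
      using f k unfolding Homeo_plus_def leaf_orientation_preserving_def by blast
    define d where "d x = g x - (x + \<phi> (sol_proj x k))" for x
    have d_int: "d x \<in> \<int>" for x
    proof -
      have "sol_proj (x + \<phi> (sol_proj x k)) k = sol_proj (g x) l"
        using fg[of x] k by (simp add: \<phi>(2) add.commute)
      then obtain t :: int where "g x = x + \<phi> (sol_proj x k) + of_int t"
        using sol_proj_eqD k l by metis
      then show ?thesis by (simp add: d_def)
    qed
    have "continuous_on UNIV d"
      unfolding d_def using inc_homeo_continuous[OF g] continuous_on_leaf[OF \<phi>(1) k]
      by (intro continuous_intros)
    then have "d constant_on UNIV"
    proof (rule continuous_discrete_range_constant[OF connected_UNIV])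
      fix x
      have "1 \<le> \<bar>d y - d x\<bar>" if "d y \<noteq> d x" for y
        using that d_int by (intro Ints_nonzero_abs_ge1 Ints_diff) auto
      then show "\<exists>e>0. \<forall>y. y \<in> UNIV \<and> d y \<noteq> d x \<longrightarrow> e \<le> norm (d y - d x)"
        by (intro exI[of _ 1]) auto
    qed
    then obtain c where "\<And>x. d x = c" by (auto simp: constant_on_def)
    then have "(\<lambda>x. x + \<phi> (sol_proj x k)) = (\<lambda>x. g x - c)" by (auto simp: d_def fun_eq_iff algebra_simps)
    moreover have "\<exists>x. y = g x - c" for y
    proof -
      obtain x where "y + c = g x" using g unfolding inc_homeo_iff surj_def by blast
      then show ?thesis by (auto simp: algebra_simps)
    qed
    then have "surj (\<lambda>x. g x - c)" by (simp add: surj_def)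
    ultimately show ?thesis using g by (simp add: inc_homeo_iff strict_mono_def)
  qed
  then show ?thesis using that \<phi> by (auto simp: displaced_by_def)
qed

lemma Homeo_plus_iff:
  "f \<in> Homeo_plus \<longleftrightarrow> f \<in> extensional solenoid \<and> (\<exists>\<phi>. displaced_by f \<phi>)"
proof
  assume f: "f \<in> Homeo_plus"
  then show "f \<in> extensional solenoid \<and> (\<exists>\<phi>. displaced_by f \<phi>)"
    using Homeo_plus_displaced_by[OF f] by (auto simp: Homeo_plus_def)
qed (use displaced_by_Homeo_plus in blast)

lemma displaced_by_in: "displaced_by f \<phi> \<Longrightarrow> s \<in> solenoid \<Longrightarrow> f s \<in> solenoid"
  by (simp add: displaced_by_def)

lemma displaced_by_sol_proj:
  "displaced_by f \<phi> \<Longrightarrow> k \<in> Zhat \<Longrightarrow> f (sol_proj x k) = sol_proj (x + \<phi> (sol_proj x k)) k"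
  by (simp add: displaced_by_def add.commute)

lemma displaced_by_lift:
  assumes f: "displaced_by f \<phi>"
  shows "is_lift f (\<lambda>k x. x + \<phi> (sol_proj x k))"
  unfolding is_lift_def
proof (intro conjI ballI allI)
  have \<phi>: "continuous_map solenoid_top euclideanreal \<phi>" using f by (simp add: displaced_by_def)
  from continuous_map_compose[OF continuous_map_sol_proj \<phi>]
  have "continuous_map (prod_topology euclidean Zhat_top) euclideanreal (\<lambda>z. \<phi> (sol_proj (fst z) (snd z)))"
    by (simp add: o_def case_prod_beta')
  then have "continuous_map (prod_topology euclidean Zhat_top) (prod_topology euclidean Zhat_top)
      (\<lambda>z. (fst z + \<phi> (sol_proj (fst z) (snd z)), snd z))"
    by (intro continuous_map_pairedI continuous_map_add continuous_map_fst continuous_map_snd)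
  then show "continuous_map (prod_topology euclidean Zhat_top) (prod_topology euclidean Zhat_top)
      (\<lambda>(x, k). (x + \<phi> (sol_proj x k), k))"
    by (simp add: case_prod_beta')
  obtain B where B: "\<And>s. s \<in> solenoid \<Longrightarrow> \<bar>\<phi> s\<bar> \<le> B" using bounded_on_solenoid[OF \<phi>] by metis
  fix k :: zhat assume k: "k \<in> Zhat"
  show "sol_proj (x + \<phi> (sol_proj x k)) k = f (sol_proj x k)" for x
    using displaced_by_sol_proj[OF f k] by simp
  show "inc_homeo (\<lambda>x. x + \<phi> (sol_proj x k))" using f k by (simp add: displaced_by_def)
  show "x + of_int t + \<phi> (sol_proj (x + of_int t) (invlim_diff k (emb t))) = x + \<phi> (sol_proj x k) + of_int t"
    for x and t :: int
    by (simp add: sol_proj_diff_emb[OF k])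
  show "bounded (range (displacement (\<lambda>k x. x + \<phi> (sol_proj x k)) k))"
    unfolding bounded_iff displacement_def using B[OF sol_proj_in[OF k]] by auto
  show "continuous_on UNIV (displacement (\<lambda>k x. x + \<phi> (sol_proj x k)) k)"
    using continuous_on_leaf[OF \<phi> k] by (simp add: displacement_def)
qed

text \<open>Leaves are parametrised injectively, so any lift has the displacement given by \<phi>.
  The lift quantified in \<open>Homeo_plus_p_def\<close> can then be replaced by \<phi>.\<close>

lemma displacement_lift_unique:
  assumes f: "displaced_by f \<phi>" and F: "is_lift f F" and k: "k \<in> Zhat"
  shows "displacement F k = (\<lambda>x. \<phi> (sol_proj x k))"
proof
  fix x
  have "sol_proj (F k x) k = sol_proj (x + \<phi> (sol_proj x k)) k"
    using displaced_by_sol_proj[OF f k] F k by (auto simp: is_lift_def)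
  then have "F k x = x + \<phi> (sol_proj x k)" using k by (rule sol_proj_inject)
  then show "displacement F k x = \<phi> (sol_proj x k)" by (simp add: displacement_def)
qed

text \<open>Pairs on which \<phi> differs by at least \<open>e\<close> form a compact set off the
  diagonal. Each is separated by some character, hence finitely many characters separate them
  all.\<close>

lemma uniformly_continuous_solenoid:
  assumes \<phi>: "continuous_map solenoid_top euclideanreal \<phi>" and e: "e > 0"
  obtains n :: nat where "n \<ge> 1"
    "\<And>s t. s \<in> solenoid \<Longrightarrow> t \<in> solenoid \<Longrightarrow> s n = t n \<Longrightarrow> \<bar>\<phi> s - \<phi> t\<bar> < e"
proof -
  define Y where "Y = prod_topology solenoid_top solenoid_top"
  have Y: "compact_space Y"
    using compact_space_solenoid by (simp add: Y_def compact_space_prod_topology)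
  have 1: "continuous_map Y solenoid_top fst" and 2: "continuous_map Y solenoid_top snd"
    unfolding Y_def by (rule continuous_map_fst continuous_map_snd)+
  define B where "B = {z \<in> topspace Y. \<bar>\<phi> (fst z) - \<phi> (snd z)\<bar> \<in> {e..}}"
  have "closedin Y B"
    unfolding B_def
  proof (rule closedin_continuous_map_preimage)
    show "continuous_map Y euclideanreal (\<lambda>z. \<bar>\<phi> (fst z) - \<phi> (snd z)\<bar>)"
      using continuous_map_compose[OF 1 \<phi>] continuous_map_compose[OF 2 \<phi>]
      by (intro continuous_map_real_abs continuous_map_diff) (simp_all add: o_def)
  qed simp
  then have B: "compactin Y B" using Y closedin_compact_space by blast
  define U where "U n = topspace Y - {z \<in> topspace Y. sol_char n (fst z) = sol_char n (snd z)}" for n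
  have "openin Y (U n)" if "n \<ge> 1" for n
  proof -
    have "closedin Y {z \<in> topspace Y. sol_char n (fst z) = sol_char n (snd z)}"
      using continuous_map_compose[OF 1 continuous_map_sol_char[OF that]]
        continuous_map_compose[OF 2 continuous_map_sol_char[OF that]]
      by (intro closedin_continuous_maps_eq[where Y = euclidean]) (simp_all add: o_def)
    then show ?thesis unfolding U_def by blast
  qed
  moreover have "B \<subseteq> \<Union>(U ` {1..})"
  proof
    fix z assume z: "z \<in> B"
    then have "fst z \<noteq> snd z" "fst z \<in> solenoid" "snd z \<in> solenoid"
      using e by (auto simp: B_def Y_def topspace_invlim_top)
    then obtain n where "n \<ge> 1" "sol_char n (fst z) \<noteq> sol_char n (snd z)" using sol_char_inject by blast
    then show "z \<in> \<Union>(U ` {1..})" using z by (auto simp: U_def B_def)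
  qed
  ultimately obtain \<F> where \<F>: "finite \<F>" "\<F> \<subseteq> U ` {1..}" "B \<subseteq> \<Union>\<F>"
    using compactinD[OF B, of "U ` {1..}"] by (metis (no_types, lifting) atLeast_iff imageE)
  obtain J where J: "finite J" "J \<subseteq> {1..}" "\<F> = U ` J" using finite_subset_image[OF \<F>(1,2)] by blast
  \<comment> \<open>The product is a common multiple of \<open>J\<close>: agreement at this
    coordinate forces agreement at every index in \<open>J\<close>. It is 1 if \<open>J\<close> is
    empty.\<close>
  have n: "\<Prod>J \<ge> 1" using J by (intro prod_ge_1) auto
  show ?thesis
  proof (rule that[OF n])
    fix s t :: sol assume s: "s \<in> solenoid" and t: "t \<in> solenoid" and eq: "s (\<Prod>J) = t (\<Prod>J)"
    have "(s, t) \<notin> U m" if m: "m \<in> J" for m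
    proof -
      have m1: "m \<ge> 1" "m dvd \<Prod>J" using m J dvd_prod_eqI[of J m m "\<lambda>x. x"] by auto
      have "s m = bond m (s (\<Prod>J))" "t m = bond m (t (\<Prod>J))"
        using s t m1 n by (auto simp: invlim_def)
      then show ?thesis using eq by (simp add: U_def sol_char_def)
    qed
    then have "(s, t) \<notin> B" using \<F>(3) J(3) by blast
    then show "\<bar>\<phi> s - \<phi> t\<bar> < e" using s t by (auto simp: B_def Y_def topspace_invlim_top)
  qed
qed

lemma sol_proj_add_multiple:
  assumes k: "k \<in> Zhat" and n: "n \<ge> 1"
  shows "sol_proj (x + of_int j * of_nat n) k n = sol_proj x k n"
proof -
  obtain a where a: "k n = cls n a" using k n by (rule invlimD)
  have "cls n (x + real_of_int a) = cls n (x + of_int j * of_nat n + of_int a)"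
    by (subst cls_eq_iff) (auto simp: algebra_simps)
  then show ?thesis using sol_proj_cls[where k = k, OF n a] by metis
qed

text \<open>Moving along a leaf by a multiple of \<open>n\<close> leaves coordinate \<open>n\<close>
  unchanged. The same \<open>n\<close> works for all leaves and all multiples.\<close>

lemma leaf_almost_periods:
  assumes \<phi>: "continuous_map solenoid_top euclideanreal \<phi>" and e: "e > 0"
  obtains n :: nat where "n \<ge> 1"
    "\<And>k x j::int. k \<in> Zhat \<Longrightarrow>
      \<bar>\<phi> (sol_proj (x + of_int j * of_nat n) k) - \<phi> (sol_proj x k)\<bar> < e"
proof -
  obtain n :: nat where n: "n \<ge> 1"
    "\<And>s t. s \<in> solenoid \<Longrightarrow> t \<in> solenoid \<Longrightarrow> s n = t n \<Longrightarrow> \<bar>\<phi> s - \<phi> t\<bar> < e"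
    using uniformly_continuous_solenoid[OF \<phi> e] by metis
  show ?thesis
    by (rule that[OF n(1)]) (intro n(2) sol_proj_in sol_proj_add_multiple n(1), assumption+)
qed

text \<open>Every leaf is dense, so a period on one leaf is a period on the whole solenoid.\<close>

lemma period_leaf_imp_global:
  assumes \<phi>: "continuous_map solenoid_top euclideanreal \<phi>" and k: "k \<in> Zhat"
    and per: "\<And>x. \<phi> (sol_proj (x + T) k) = \<phi> (sol_proj x k)" and s: "s \<in> solenoid"
  shows "\<phi> (sol_shift T s) = \<phi> s"
proof (rule ccontr)
  assume ne: "\<phi> (sol_shift T s) \<noteq> \<phi> s"
  define e where "e = \<bar>\<phi> (sol_shift T s) - \<phi> s\<bar> / 2"
  have "e > 0" using ne by (simp add: e_def)
  then obtain n :: nat where n: "n \<ge> 1"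
    and unif: "\<And>s t. s \<in> solenoid \<Longrightarrow> t \<in> solenoid \<Longrightarrow> s n = t n \<Longrightarrow> \<bar>\<phi> s - \<phi> t\<bar> < e"
    using uniformly_continuous_solenoid[OF \<phi>] by metis
  obtain x where x: "s n = cls n x" using s n by (rule invlimD)
  obtain a where a: "k n = cls n a" using k n by (rule invlimD)
  \<comment> \<open>As \<open>k n\<close> is the class of \<open>a\<close>, the parameter
    \<open>x - a\<close> gives a point of the leaf of \<open>k\<close> sharing coordinate
    \<open>n\<close> with \<open>s\<close>. Shifting both by \<open>T\<close> preserves this
    agreement.\<close>
  have 1: "s n = sol_proj (x - of_int a) k n"
    using sol_proj_cls[where k = k, OF n a] x by simp
  have "sol_shift T s n = sol_proj (x - of_int a + T) k n"
    using sol_proj_cls[where k = k, OF n a] sol_shift_cls[where s = s, OF n x] by (simp add: add.commute)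
  then have "\<bar>\<phi> (sol_shift T s) - \<phi> (sol_proj (x - of_int a + T) k)\<bar> < e"
    using s k by (intro unif) auto
  moreover have "\<bar>\<phi> s - \<phi> (sol_proj (x - of_int a) k)\<bar> < e" using s k 1 by (intro unif) auto
  ultimately show False using per[of "x - of_int a"] by (simp add: e_def abs_if split: if_splits)
qed

lemma periodic_leaf_integer_period:
  assumes \<phi>: "continuous_map solenoid_top euclideanreal \<phi>" and k: "k \<in> Zhat"
    and per: "periodic (\<lambda>x. \<phi> (sol_proj x k))"
  obtains m :: nat where "m \<ge> 1" "\<And>s. s \<in> solenoid \<Longrightarrow> \<phi> (sol_shift (of_nat m) s) = \<phi> s"
proof -
  obtain T where T: "T \<noteq> 0" "\<And>x. \<phi> (sol_proj (x + T) k) = \<phi> (sol_proj x k)"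
    using per by (auto simp: periodic_def)
  have "\<exists>n\<ge>1::nat. \<forall>x. \<forall>j::int. \<bar>\<phi> (sol_proj (x + of_int j * of_nat n) k) - \<phi> (sol_proj x k)\<bar> \<le> e"
    if "e > 0" for e
    using leaf_almost_periods[OF \<phi> that] k by (metis less_imp_le)
  then obtain m :: nat where "m \<ge> 1" "\<And>x. \<phi> (sol_proj (x + of_nat m) k) = \<phi> (sol_proj x k)"
    using integer_period[where d = "\<lambda>x. \<phi> (sol_proj x k)", OF continuous_on_leaf[OF \<phi> k] T] by metis
  then show ?thesis using that period_leaf_imp_global[OF \<phi> k] by blast
qed

lemma periodic_of_global_period:
  assumes \<phi>: "continuous_map solenoid_top euclideanreal \<phi>" and k: "k \<in> Zhat" and m: "m \<ge> 1"
    and per: "\<And>s. s \<in> solenoid \<Longrightarrow> \<phi> (sol_shift (real m) s) = \<phi> s"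
  shows "periodic (\<lambda>x. \<phi> (sol_proj x k))"
  unfolding periodic_def
proof (intro conjI exI allI)
  show "continuous_on UNIV (\<lambda>x. \<phi> (sol_proj x k))" using \<phi> k by (rule continuous_on_leaf)
  show "real m \<noteq> 0" using m by simp
  show "\<phi> (sol_proj (x + real m) k) = \<phi> (sol_proj x k)" for x
    using per[OF sol_proj_in[OF k, of x]] by (simp add: add.commute)
qed

text \<open>The leaf through \<open>emb 0\<close> represents all leaves, and one integer period of
  \<phi> under the flow replaces the separate periods of the displacements. Stability under group
  operations is checked in this form.\<close>

lemma Homeo_plus_p_iff:
  "f \<in> Homeo_plus_p \<longleftrightarrow> f \<in> extensional solenoid \<and>
     (\<exists>\<phi> m. displaced_by f \<phi> \<and> m \<ge> 1 \<and> (\<forall>s\<in>solenoid. \<phi> (sol_shift (real m) s) = \<phi> s))"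
proof
  assume f: "f \<in> Homeo_plus_p"
  then have "f \<in> Homeo_plus" by (simp add: Homeo_plus_p_def)
  then obtain \<phi> where \<phi>: "displaced_by f \<phi>" by (rule Homeo_plus_displaced_by)
  obtain F where F: "is_lift f F" "\<And>k. k \<in> Zhat \<Longrightarrow> periodic (displacement F k)"
    using f by (auto simp: Homeo_plus_p_def)
  have "periodic (\<lambda>x. \<phi> (sol_proj x (emb 0)))"
    using F(2)[OF emb_in] displacement_lift_unique[OF \<phi> F(1) emb_in] by metis
  moreover have "continuous_map solenoid_top euclideanreal \<phi>" using \<phi> by (simp add: displaced_by_def)
  ultimately obtain m :: nat where "m \<ge> 1" "\<And>s. s \<in> solenoid \<Longrightarrow> \<phi> (sol_shift (of_nat m) s) = \<phi> s"
    using periodic_leaf_integer_period[OF _ emb_in] by metis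
  then show "f \<in> extensional solenoid \<and>
     (\<exists>\<phi> m. displaced_by f \<phi> \<and> m \<ge> 1 \<and> (\<forall>s\<in>solenoid. \<phi> (sol_shift (real m) s) = \<phi> s))"
    using \<phi> \<open>f \<in> Homeo_plus\<close> by (auto simp: Homeo_plus_def)
next
  assume f: "f \<in> extensional solenoid \<and>
     (\<exists>\<phi> m. displaced_by f \<phi> \<and> m \<ge> 1 \<and> (\<forall>s\<in>solenoid. \<phi> (sol_shift (real m) s) = \<phi> s))"
  then obtain \<phi> m where \<phi>: "displaced_by f \<phi>" and m: "m \<ge> 1"
    "\<And>s. s \<in> solenoid \<Longrightarrow> \<phi> (sol_shift (real m) s) = \<phi> s" by blast
  have cont: "continuous_map solenoid_top euclideanreal \<phi>" using \<phi> by (simp add: displaced_by_def)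
  have "f \<in> Homeo_plus" using f \<phi> displaced_by_Homeo_plus by blast
  moreover have "periodic (displacement (\<lambda>k x. x + \<phi> (sol_proj x k)) k)" if "k \<in> Zhat" for k
    using periodic_of_global_period[OF cont that m] by (simp add: displacement_def)
  ultimately show "f \<in> Homeo_plus_p"
    unfolding Homeo_plus_p_def using displaced_by_lift[OF \<phi>] by blast
qed

section \<open>The group, limit periodicity and density\<close>

text \<open>If \<open>t\<close> is the preimage of \<open>s\<close>, then \<open>s\<close> is
  \<open>t\<close> shifted by \<open>\<phi> t\<close>, so the inverse shifts back by the same
  amount. On each leaf its lift inverts the increasing lift of \<open>f\<close>.\<close>

lemma Homeo_plus_inv_displaced:
  assumes f: "displaced_by f \<phi>" and ext: "f \<in> extensional solenoid"
  shows "displaced_by (\<lambda>s\<in>solenoid. inv_into solenoid f s) (\<lambda>s. - \<phi> (inv_into solenoid f s))"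
proof -
  have \<phi>: "continuous_map solenoid_top euclideanreal \<phi>" using f by (simp add: displaced_by_def)
  have "f \<in> Homeo_plus" using ext f by (rule displaced_by_Homeo_plus)
  then have homeo: "homeomorphic_map solenoid_top solenoid_top f" by (simp add: Homeo_plus_def)
  then have bij: "f ` solenoid = solenoid" "inj_on f solenoid"
    using homeomorphic_imp_surjective_map homeomorphic_imp_injective_map
    by (fastforce simp: topspace_invlim_top)+
  let ?g = "inv_into solenoid f"
  have g: "?g s \<in> solenoid" "f (?g s) = s" if "s \<in> solenoid" for s
    using that bij(1) by (simp_all add: inv_into_into f_inv_into_f)
  obtain h where "homeomorphic_maps solenoid_top solenoid_top f h"
    using homeo homeomorphic_map_maps by blast
  then have h: "continuous_map solenoid_top solenoid_top h" "\<And>s. s \<in> solenoid \<Longrightarrow> h (f s) = s"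
    by (simp_all add: homeomorphic_maps_def topspace_invlim_top)
  have "continuous_map solenoid_top solenoid_top ?g"
    using h(1) by (rule continuous_map_eq) (use h(2) g in \<open>metis topspace_invlim_top\<close>)
  then have cont: "continuous_map solenoid_top euclideanreal (\<lambda>s. - \<phi> (?g s))"
    using continuous_map_compose[OF _ \<phi>] by (simp add: o_def)
  have shift: "?g s = sol_shift (- \<phi> (?g s)) s" if s: "s \<in> solenoid" for s
  proof -
    have "s = sol_shift (\<phi> (?g s)) (?g s)" using f g[OF s] by (simp add: displaced_by_def)
    then have "sol_shift (- \<phi> (?g s)) s = sol_shift (- \<phi> (?g s)) (sol_shift (\<phi> (?g s)) (?g s))" by metis
    then show ?thesis using g(1)[OF s] by simp
  qed
  have "inc_homeo (\<lambda>x. x + - \<phi> (?g (sol_proj x k)))" if k: "k \<in> Zhat" for k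
  proof -
    define F where "F x = x + \<phi> (sol_proj x k)" for x
    define G where "G x = x + - \<phi> (?g (sol_proj x k))" for x
    have F: "strict_mono F" using f k by (simp add: displaced_by_def F_def[abs_def] inc_homeo_iff)
    have "?g (sol_proj x k) = sol_proj (G x) k" for x
      using shift[OF sol_proj_in[OF k, of x]] k by (simp add: G_def add.commute)
    then have fG: "f (sol_proj (G x) k) = sol_proj x k" for x
      using g(2)[OF sol_proj_in[OF k, of x]] by simp
    have "sol_proj (F (G x)) k = sol_proj x k" for x
      using fG[of x] displaced_by_sol_proj[OF f k, of "G x"] by (simp add: F_def)
    then have FG: "F (G x) = x" for x using k by (rule sol_proj_inject)
    have GF: "G (F x) = x" for x
    proof -
      have "F (G (F x)) = F x" by (rule FG)
      then show ?thesis using F by (simp add: strict_mono_eq)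
    qed
    have "strict_mono G"
    proof (rule strict_monoI)
      fix x y :: real assume "x < y"
      then have "F (G x) < F (G y)" by (simp add: FG)
      then show "G x < G y" using F by (simp add: strict_mono_less)
    qed
    moreover have "surj G" using GF by (rule surjI)
    ultimately show ?thesis by (simp add: inc_homeo_iff G_def[abs_def])
  qed
  then show ?thesis using cont shift by (simp add: displaced_by_def)
qed

text \<open>Displacements obey the cocycle rule: the shift by \<open>\<gamma> s\<close> is followed
  by the one prescribed at \<open>g s\<close>. On each leaf the lifts compose.\<close>

lemma compose_displaced:
  assumes f: "displaced_by f \<phi>" and g: "displaced_by g \<gamma>"
  shows "displaced_by (compose solenoid f g) (\<lambda>s. \<gamma> s + \<phi> (g s))"
  unfolding displaced_by_def
proof (intro conjI ballI)
  have \<phi>: "continuous_map solenoid_top euclideanreal \<phi>"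
    and \<gamma>: "continuous_map solenoid_top euclideanreal \<gamma>"
    using f g by (simp_all add: displaced_by_def)
  have "continuous_map solenoid_top solenoid_top (\<lambda>s. sol_shift (\<gamma> s) s)"
    using \<gamma> by (intro continuous_map_sol_shift continuous_map_id[unfolded id_def])
  then have "continuous_map solenoid_top solenoid_top g"
    by (rule continuous_map_eq) (use g in \<open>simp add: displaced_by_def topspace_invlim_top\<close>)
  from continuous_map_compose[OF this \<phi>]
  show "continuous_map solenoid_top euclideanreal (\<lambda>s. \<gamma> s + \<phi> (g s))"
    using \<gamma> by (intro continuous_map_add) (simp_all add: o_def)
  show "compose solenoid f g s = sol_shift (\<gamma> s + \<phi> (g s)) s" if s: "s \<in> solenoid" for s
  proof -
    have "compose solenoid f g s = sol_shift (\<phi> (g s)) (g s)"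
      using f s displaced_by_in[OF g s] by (simp add: compose_def displaced_by_def)
    also have "\<dots> = sol_shift (\<phi> (g s)) (sol_shift (\<gamma> s) s)"
      using g s by (simp add: displaced_by_def)
    finally show ?thesis using s by (simp add: add.commute)
  qed
  fix k :: zhat assume k: "k \<in> Zhat"
  let ?F = "\<lambda>x. x + \<phi> (sol_proj x k)" and ?G = "\<lambda>x. x + \<gamma> (sol_proj x k)"
  have "strict_mono ?F" "surj ?F" "strict_mono ?G" "surj ?G"
    using f g k by (auto simp: displaced_by_def inc_homeo_iff)
  then have "strict_mono (?F \<circ> ?G)" "surj (?F \<circ> ?G)"
    by (simp add: strict_mono_def, metis comp_surj)
  moreover have "(\<lambda>x. x + (\<gamma> (sol_proj x k) + \<phi> (g (sol_proj x k)))) = ?F \<circ> ?G"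
    using displaced_by_sol_proj[OF g k] by (auto simp: o_def)
  ultimately show "inc_homeo (\<lambda>x. x + (\<gamma> (sol_proj x k) + \<phi> (g (sol_proj x k))))"
    by (simp only: inc_homeo_iff)
qed

lemma id_displaced: "displaced_by (\<lambda>s\<in>solenoid. s) (\<lambda>s. 0)"
  by (auto simp: displaced_by_def inc_homeo_iff strict_mono_def)

lemma Homeo_plus_subset_Bij: "Homeo_plus \<subseteq> Bij solenoid"
proof
  fix f assume f: "f \<in> Homeo_plus"
  then have "homeomorphic_map solenoid_top solenoid_top f" by (simp add: Homeo_plus_def)
  then have "f ` solenoid = solenoid" "inj_on f solenoid"
    using homeomorphic_imp_surjective_map homeomorphic_imp_injective_map
    by (fastforce simp: topspace_invlim_top)+
  then show "f \<in> Bij solenoid" using f by (simp add: Bij_def bij_betw_def Homeo_plus_def)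
qed

lemma subgroup_BijGroupI:
  assumes "A \<subseteq> Bij S" "(\<lambda>x\<in>S. x) \<in> A"
    "\<And>f g. f \<in> A \<Longrightarrow> g \<in> A \<Longrightarrow> compose S f g \<in> A"
    "\<And>f. f \<in> A \<Longrightarrow> (\<lambda>x\<in>S. inv_into S f x) \<in> A"
  shows "subgroup A (BijGroup S)"
proof (rule subgroup.intro)
  show "A \<subseteq> carrier (BijGroup S)" using assms(1) by (simp add: BijGroup_def)
  show "\<one>\<^bsub>BijGroup S\<^esub> \<in> A" using assms(2) by (simp add: BijGroup_def)
  show "f \<otimes>\<^bsub>BijGroup S\<^esub> g \<in> A" if "f \<in> A" "g \<in> A" for f g
    using that assms(1,3) by (auto simp: BijGroup_def)
  show "inv\<^bsub>BijGroup S\<^esub> f \<in> A" if "f \<in> A" for f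
    using that assms(1,4) inv_BijGroup[of f S] by auto
qed

lemma Homeo_plus_subgroup: "subgroup Homeo_plus (BijGroup solenoid)"
proof (rule subgroup_BijGroupI[OF Homeo_plus_subset_Bij])
  show "(\<lambda>s\<in>solenoid. s) \<in> Homeo_plus" using id_displaced by (rule displaced_by_Homeo_plus[rotated]) simp
  fix f assume f: "f \<in> Homeo_plus"
  then obtain \<phi> where \<phi>: "displaced_by f \<phi>" "f \<in> extensional solenoid" by (auto simp: Homeo_plus_iff)
  show "(\<lambda>s\<in>solenoid. inv_into solenoid f s) \<in> Homeo_plus"
    using Homeo_plus_inv_displaced[OF \<phi>] by (rule displaced_by_Homeo_plus[rotated]) simp
  fix g assume "g \<in> Homeo_plus"
  then obtain \<gamma> where \<gamma>: "displaced_by g \<gamma>" by (auto simp: Homeo_plus_iff)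
  show "compose solenoid f g \<in> Homeo_plus"
    using compose_displaced[OF \<phi>(1) \<gamma>] by (rule displaced_by_Homeo_plus[rotated]) simp
qed

text \<open>Both sides shift \<open>s\<close> by \<open>r + \<phi> s\<close>. Commuting with the
  flow at a period is what carries periods through inverses and composites.\<close>

lemma displaced_by_commutes_with_period:
  assumes f: "displaced_by f \<phi>" and s: "s \<in> solenoid" and per: "\<phi> (sol_shift r s) = \<phi> s"
  shows "f (sol_shift r s) = sol_shift r (f s)"
  using assms by (simp add: displaced_by_def add.commute)

lemma period_multiple:
  assumes per: "\<And>s. s \<in> solenoid \<Longrightarrow> \<phi> (sol_shift (real m) s) = \<phi> s" and s: "s \<in> solenoid"
  shows "\<phi> (sol_shift (real (j * m)) s) = \<phi> s"
proof (induction j)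
  case (Suc j)
  have "sol_shift (real (Suc j * m)) s = sol_shift (real m) (sol_shift (real (j * m)) s)"
    using s by simp
  then show ?case using per[of "sol_shift (real (j * m)) s"] s Suc by simp
qed (use s in simp)

text \<open>The inverse keeps the period \<open>m\<close> because it too commutes with the shift by
  \<open>m\<close>. For a composite, \<open>m * l\<close> is a multiple of both periods, and
  \<open>g\<close> passes this shift on to the argument of \<phi>.\<close>

lemma Homeo_plus_p_subgroup: "subgroup Homeo_plus_p (BijGroup solenoid)"
proof (rule subgroup_BijGroupI)
  show "Homeo_plus_p \<subseteq> Bij solenoid" using Homeo_plus_subset_Bij by (auto simp: Homeo_plus_p_def)
  have "(1::nat) \<ge> 1 \<and> (\<forall>s\<in>solenoid. (\<lambda>s. 0::real) (sol_shift (real 1) s) = (\<lambda>s. 0) s)" by simp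
  then show "(\<lambda>s\<in>solenoid. s) \<in> Homeo_plus_p"
    unfolding Homeo_plus_p_iff using id_displaced by blast
  fix f assume "f \<in> Homeo_plus_p"
  then obtain \<phi> m where f: "f \<in> extensional solenoid" "displaced_by f \<phi>" and m: "m \<ge> 1"
    and \<phi>_per: "\<And>s. s \<in> solenoid \<Longrightarrow> \<phi> (sol_shift (real m) s) = \<phi> s" by (auto simp: Homeo_plus_p_iff)
  have bij: "f \<in> Bij solenoid"
    using displaced_by_Homeo_plus[OF f] Homeo_plus_subset_Bij by blast
  have "- \<phi> (inv_into solenoid f (sol_shift (real m) s)) = - \<phi> (inv_into solenoid f s)"
    if s: "s \<in> solenoid" for s
  proof -
    define t where "t = inv_into solenoid f s"
    have t: "t \<in> solenoid" "f t = s"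
      using s bij by (simp_all add: t_def Bij_def bij_betw_def inv_into_into f_inv_into_f)
    then have "f (sol_shift (real m) t) = sol_shift (real m) s"
      using displaced_by_commutes_with_period[OF f(2) t(1) \<phi>_per[OF t(1)]] by simp
    then have "inv_into solenoid f (sol_shift (real m) s) = sol_shift (real m) t"
      using bij t by (intro inv_into_f_eq) (auto simp: Bij_def bij_betw_def)
    then show ?thesis using \<phi>_per[OF t(1)] by (simp add: t_def)
  qed
  then show "(\<lambda>s\<in>solenoid. inv_into solenoid f s) \<in> Homeo_plus_p"
    unfolding Homeo_plus_p_iff using Homeo_plus_inv_displaced[OF f(2,1)] m
    by (intro conjI restrict_extensional exI ballI)
  fix g assume "g \<in> Homeo_plus_p"
  then obtain \<gamma> l where g: "displaced_by g \<gamma>" and l: "l \<ge> 1"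
    and \<gamma>_per: "\<And>s. s \<in> solenoid \<Longrightarrow> \<gamma> (sol_shift (real l) s) = \<gamma> s" by (auto simp: Homeo_plus_p_iff)
  have "\<gamma> (sol_shift (real (m * l)) s) + \<phi> (g (sol_shift (real (m * l)) s)) = \<gamma> s + \<phi> (g s)"
    if s: "s \<in> solenoid" for s
  proof -
    have 1: "\<gamma> (sol_shift (real (m * l)) s) = \<gamma> s" using \<gamma>_per s by (rule period_multiple)
    have "\<phi> (sol_shift (real (l * m)) (g s)) = \<phi> (g s)"
      using \<phi>_per displaced_by_in[OF g s] by (rule period_multiple)
    then show ?thesis using displaced_by_commutes_with_period[OF g s 1] 1 by (simp add: mult.commute)
  qed
  moreover have "m * l \<ge> 1" using m l by simp
  ultimately show "compose solenoid f g \<in> Homeo_plus_p"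
    unfolding Homeo_plus_p_iff using compose_displaced[OF f(2) g]
    by (intro conjI compose_extensional exI ballI)
qed

section \<open>Limit periodicity of displacements and the dichotomy\<close>

lemma displacement_limit_periodic:
  assumes f: "displaced_by f \<phi>" and k: "k \<in> Zhat"
  shows "limit_periodic (\<lambda>x. \<phi> (sol_proj x k))"
proof -
  have \<phi>: "continuous_map solenoid_top euclideanreal \<phi>" using f by (simp add: displaced_by_def)
  let ?F = "\<lambda>x. x + \<phi> (sol_proj x k)"
  have F: "inc_homeo ?F" using f k by (simp add: displaced_by_def)
  have "\<exists>u. periodic u \<and> (\<forall>x. \<bar>u x - \<phi> (sol_proj x k)\<bar> \<le> 2 * e)" if "e > 0" for e
  proof -
    obtain n :: nat where n: "n \<ge> 1"
      "\<And>x j::int. \<bar>\<phi> (sol_proj (x + of_int j * of_nat n) k) - \<phi> (sol_proj x k)\<bar> < e"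
      using leaf_almost_periods[OF \<phi> \<open>e > 0\<close>] k by metis
    have "\<bar>?F (x + of_int j * of_nat n) - (?F x + of_int j * of_nat n)\<bar> \<le> e" for x and j :: int
      using n(2)[of x j] by (simp add: less_imp_le)
    moreover have "real n > 0" using n by simp
    ultimately obtain G where G: "inc_homeo G" "\<And>x. G (x + of_nat n) = G x + of_nat n"
        "\<And>x. \<bar>G x - ?F x\<bar> \<le> 2 * e"
      using inc_homeo_periodic_approx[OF F] by metis
    have "periodic (\<lambda>x. G x - x)"
      unfolding periodic_def
    proof (intro conjI exI allI)
      show "continuous_on UNIV (\<lambda>x. G x - x)"
        using inc_homeo_continuous[OF G(1)] by (intro continuous_intros)
      show "real n \<noteq> 0" using n by simp
      show "G (x + real n) - (x + real n) = G x - x" for x by (simp add: G(2))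
    qed
    moreover have "\<bar>G x - x - \<phi> (sol_proj x k)\<bar> \<le> 2 * e" for x using G(3)[of x] by (simp add: diff_diff_eq)
    ultimately show ?thesis by blast
  qed
  \<comment> \<open>The tolerances 1/(n+1) are positive for every \<open>n\<close>, including 0, and
    tend to 0; choosing one approximant for each gives a uniformly convergent sequence.\<close>
  then have "\<exists>u. periodic u \<and> (\<forall>x. \<bar>u x - \<phi> (sol_proj x k)\<bar> \<le> 2 * inverse (real (Suc n)))" for n
    by simp
  then obtain u where u: "\<And>n. periodic (u n)"
      "\<And>n x. \<bar>u n x - \<phi> (sol_proj x k)\<bar> \<le> 2 * inverse (real (Suc n))" by metis
  have "uniform_limit UNIV u (\<lambda>x. \<phi> (sol_proj x k)) sequentially"
  proof (rule uniform_limitI)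
    fix e :: real assume "e > 0"
    have "(\<lambda>n. 2 * inverse (real (Suc n))) \<longlonglongrightarrow> 2 * 0"
      by (intro tendsto_mult tendsto_const LIMSEQ_inverse_real_of_nat)
    then have "eventually (\<lambda>n. 2 * inverse (real (Suc n)) < e) sequentially"
      using \<open>e > 0\<close> by (intro order_tendstoD(2)) auto
    then show "\<forall>\<^sub>F n in sequentially. \<forall>x\<in>UNIV. dist (u n x) (\<phi> (sol_proj x k)) < e"
      by (rule eventually_mono) (use u(2) in \<open>auto simp: dist_real_def intro: le_less_trans\<close>)
  qed
  then show ?thesis using u(1) continuous_on_leaf[OF \<phi> k] unfolding limit_periodic_def by blast
qed

lemma Homeo_plus_dichotomy: "Homeo_plus = Homeo_plus_p \<union> Homeo_plus_lp"
proof
  show "Homeo_plus \<subseteq> Homeo_plus_p \<union> Homeo_plus_lp"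
  proof
    fix f assume f: "f \<in> Homeo_plus"
    then obtain \<phi> where \<phi>: "displaced_by f \<phi>" by (rule Homeo_plus_displaced_by)
    have cont: "continuous_map solenoid_top euclideanreal \<phi>" using \<phi> by (simp add: displaced_by_def)
    show "f \<in> Homeo_plus_p \<union> Homeo_plus_lp"
    \<comment> \<open>A single periodic leaf makes \<phi> globally periodic, so mixed behaviour
      cannot occur; otherwise no leaf is periodic, as the purely limit periodic class
      demands.\<close>
    proof (cases "\<exists>k\<in>Zhat. periodic (\<lambda>x. \<phi> (sol_proj x k))")
      case True
      then obtain k m where "m \<ge> 1" "\<And>s. s \<in> solenoid \<Longrightarrow> \<phi> (sol_shift (of_nat m) s) = \<phi> s"
        using periodic_leaf_integer_period[OF cont] by metis
      then have "f \<in> Homeo_plus_p"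
        unfolding Homeo_plus_p_iff using \<phi> f by (auto simp: Homeo_plus_def)
      then show ?thesis by simp
    next
      case False
      then have "purely_limit_periodic (displacement (\<lambda>k x. x + \<phi> (sol_proj x k)) k)" if "k \<in> Zhat" for k
        using that displacement_limit_periodic[OF \<phi>]
        by (simp add: purely_limit_periodic_def displacement_def)
      then have "f \<in> Homeo_plus_lp"
        unfolding Homeo_plus_lp_def using f displaced_by_lift[OF \<phi>] by blast
      then show ?thesis by simp
    qed
  qed
qed (auto simp: Homeo_plus_p_def Homeo_plus_lp_def)

text \<open>
  A homeomorphism of \<open>\<real>\<close> that commutes with the translation by \<open>n\<close> acts on \<open>\<real>/n\<int>\<close>; its displacement
  is pulled back to the solenoid along the coordinate \<open>n\<close>.
\<close>

lemma Homeo_plus_p_of_periodic: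
  assumes n: "n \<ge> 1" and G: "inc_homeo G" "\<And>x. G (x + real n) = G x + real n"
  obtains g \<gamma> where "g \<in> Homeo_plus_p" "displaced_by g \<gamma>"
    "\<And>s x. s \<in> solenoid \<Longrightarrow> s n = cls n x \<Longrightarrow> \<gamma> s = G x - x"
proof -
  \<comment> \<open>The representative chosen for a coset does not matter, because
    \<open>G x - x\<close> has period \<open>n\<close>.\<close>
  define h where "h A = (let x = SOME x. A = cls n x in G x - x)" for A
  have h: "h (cls n x) = G x - x" for x
  proof -
    have per: "G (y + real n) - (y + real n) = G y - y" for y by (simp add: G(2))
    have "cls n x = cls n (SOME y. cls n x = cls n y)" by (rule someI[of _ x]) simp
    then obtain j :: int where j: "(SOME y. cls n x = cls n y) = x + of_int j * of_nat n"
      by (auto simp: cls_eq_iff)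
    show ?thesis
      unfolding h_def Let_def j using int_multiple_period[where d = "\<lambda>y. G y - y", OF per] .
  qed
  define \<gamma> where "\<gamma> s = h (s n)" for s :: sol
  have \<gamma>: "\<gamma> s = G x - x" if "s n = cls n x" for s x using that h by (simp add: \<gamma>_def)
  define g where "g = (\<lambda>s\<in>solenoid. sol_shift (\<gamma> s) s)"
  have "continuous_map (quot_top n) euclideanreal h"
    unfolding continuous_map_from_quot h
    using inc_homeo_continuous[OF G(1)] by (simp add: continuous_on_diff)
  from continuous_map_compose[OF continuous_map_invlim_coord[OF n] this]
  have cont: "continuous_map solenoid_top euclideanreal \<gamma>" by (simp add: \<gamma>_def[abs_def] o_def)
  have "inc_homeo (\<lambda>x. x + \<gamma> (sol_proj x k))" if k: "k \<in> Zhat" for k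
  proof -
    obtain a where a: "k n = cls n a" using k n by (rule invlimD)
    have "\<gamma> (sol_proj x k) = G (x + of_int a) - (x + of_int a)" for x
      using \<gamma> sol_proj_cls[where k = k, OF n a] by blast
    \<comment> \<open>On the leaf of \<open>k\<close> the lift is \<open>G\<close> conjugated by
      translation by the integer \<open>a\<close>.\<close>
    then have eq: "(\<lambda>x. x + \<gamma> (sol_proj x k)) = (\<lambda>x. G (x + of_int a) - of_int a)" by auto
    have "surj (\<lambda>x. G (x + of_int a) - of_int a)"
    proof (rule surjI)
      show "G (inv_into UNIV G (y + of_int a) - of_int a + of_int a) - of_int a = y" for y
        using G(1) by (simp add: inc_homeo_iff surj_f_inv_f)
    qed
    then show ?thesis unfolding eq using G(1) by (simp add: inc_homeo_iff strict_mono_def)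
  qed
  then have disp: "displaced_by g \<gamma>" using cont by (simp add: displaced_by_def g_def)
  have "\<gamma> (sol_shift (real n) s) = \<gamma> s" if s: "s \<in> solenoid" for s
  proof -
    obtain x where x: "s n = cls n x" using s n by (rule invlimD)
    have "\<gamma> (sol_shift (real n) s) = G (real n + x) - (real n + x)"
      using \<gamma> sol_shift_cls[where s = s, OF n x] by blast
    then show ?thesis using \<gamma>[where s = s, OF x] G(2)[of x] by (simp add: add.commute)
  qed
  then have "g \<in> Homeo_plus_p"
    unfolding Homeo_plus_p_iff using disp n by (auto simp: g_def)
  then show ?thesis using that disp \<gamma> by blast
qed

section \<open>Density in the topology of uniform convergence\<close>

lemma openin_Homeo_plus_top:
  "openin Homeo_plus_top U \<longleftrightarrow> U \<subseteq> Homeo_plus \<and>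
     (\<forall>f\<in>U. \<exists>V. openin solenoid_top V \<and> emb 0 \<in> V \<and> unif_nbhd f V \<subseteq> U)"
  unfolding Homeo_plus_top_def by (simp add: topology_inverse'[OF istopology_Homeo_plus])

lemma topspace_Homeo_plus_top: "topspace Homeo_plus_top = Homeo_plus"
proof
  show "topspace Homeo_plus_top \<subseteq> Homeo_plus"
    using openin_Homeo_plus_top[of "topspace Homeo_plus_top"] by simp
  have "openin Homeo_plus_top Homeo_plus"
    unfolding openin_Homeo_plus_top
  proof (intro conjI ballI exI)
    show "openin solenoid_top solenoid" by (metis openin_topspace topspace_invlim_top)
  qed (auto simp: unif_nbhd_def)
  then show "Homeo_plus \<subseteq> topspace Homeo_plus_top" by (rule openin_subset)
qed

text \<open>One leaf suffices: \<phi> nearly depends on coordinate \<open>n\<close> alone, and the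
  leaf through \<open>emb 0\<close> meets every class of that coordinate. Rescaling its lift and
  pulling the result back along coordinate \<open>n\<close> approximates \<open>f\<close>
  everywhere.\<close>

lemma Homeo_plus_p_approx:
  assumes f: "f \<in> Homeo_plus" and V: "openin solenoid_top V" "emb 0 \<in> V"
  obtains g where "g \<in> Homeo_plus_p" "g \<in> unif_nbhd f V"
proof -
  obtain \<phi> where \<phi>: "displaced_by f \<phi>" using f by (rule Homeo_plus_displaced_by)
  have cont: "continuous_map solenoid_top euclideanreal \<phi>" using \<phi> by (simp add: displaced_by_def)
  have "open {r. emb r \<in> V}"
    using openin_continuous_map_preimage[OF continuous_map_emb V(1)] by simp
  then obtain e where e: "e > 0" and ball: "ball 0 e \<subseteq> {r::real. emb r \<in> V}"
    using V(2) open_contains_ball by (metis mem_Collect_eq)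
  have emb_V: "emb r \<in> V" if "\<bar>r\<bar> < e" for r :: real using ball that by auto
  \<comment> \<open>Rescaling costs at most \<open>2 * (e / 4)\<close>, and comparing
    \<open>s\<close> with a point of the base leaf sharing its coordinate \<open>n\<close> costs
    less than \<open>e / 4\<close>. The total stays below \<open>e\<close>.\<close>
  obtain n :: nat where n: "n \<ge> 1"
    and unif: "\<And>s t. s \<in> solenoid \<Longrightarrow> t \<in> solenoid \<Longrightarrow> s n = t n \<Longrightarrow> \<bar>\<phi> s - \<phi> t\<bar> < e / 4"
    using uniformly_continuous_solenoid[OF cont, of "e / 4"] e by auto
  let ?F = "\<lambda>x. x + \<phi> (sol_proj x (emb 0))"
  have F: "inc_homeo ?F" using \<phi> by (simp add: displaced_by_def)
  have "\<bar>?F (x + of_int j * of_nat n) - (?F x + of_int j * of_nat n)\<bar> \<le> e / 4" for x and j :: int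
    using unif[OF sol_proj_in sol_proj_in sol_proj_add_multiple[OF emb_in n], OF emb_in emb_in, of x j]
    by (simp add: less_imp_le)
  moreover have "real n > 0" using n by simp
  ultimately obtain G where G: "inc_homeo G" "\<And>x. G (x + of_nat n) = G x + of_nat n"
      "\<And>x. \<bar>G x - ?F x\<bar> \<le> 2 * (e / 4)"
    using inc_homeo_periodic_approx[OF F] by metis
  obtain g \<gamma> where g: "g \<in> Homeo_plus_p" "displaced_by g \<gamma>"
      and \<gamma>: "\<And>s x. s \<in> solenoid \<Longrightarrow> s n = cls n x \<Longrightarrow> \<gamma> s = G x - x"
    using Homeo_plus_p_of_periodic[OF n G(1,2)] by metis
  have "invlim_diff (g s) (f s) \<in> V" if s: "s \<in> solenoid" for s
  proof -
    obtain x where x: "s n = cls n x" using s n by (rule invlimD)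
    have "sol_proj x (emb 0) n = cls n x"
      using sol_proj_cls[where k = "emb 0", OF n emb_cls[OF n]] by simp
    then have "\<bar>\<phi> s - \<phi> (sol_proj x (emb 0))\<bar> < e / 4" using s x by (intro unif) auto
    moreover have "\<gamma> s = G x - x" using s x by (rule \<gamma>)
    ultimately have "\<bar>\<gamma> s - \<phi> s\<bar> < e" using G(3)[of x] by linarith
    moreover have "invlim_diff (g s) (f s) = emb (\<gamma> s - \<phi> s)"
      using g(2) \<phi> s invlim_diff_sol_shift[OF s] by (simp add: displaced_by_def)
    ultimately show ?thesis using emb_V by simp
  qed
  then have "g \<in> unif_nbhd f V" using g(1) by (simp add: unif_nbhd_def Homeo_plus_p_def)
  then show ?thesis using that g(1) by blast
qed

theorem theorem2p5:
  "Homeo_plus = Homeo_plus_p \<union> Homeo_plus_lp \<and>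
   subgroup Homeo_plus_p Homeo_plus_group \<and>
   Homeo_plus_top closure_of Homeo_plus_p = Homeo_plus"
proof (intro conjI)
  show "Homeo_plus = Homeo_plus_p \<union> Homeo_plus_lp" by (rule Homeo_plus_dichotomy)
  \<comment> \<open>\<open>Homeo_plus_group\<close> is the full group of bijections with a smaller
    carrier, so it is enough that both sets are subgroups of the full group and one contains the
    other.\<close>
  show "subgroup Homeo_plus_p Homeo_plus_group"
    unfolding Homeo_plus_group_def
    using group_BijGroup Homeo_plus_p_subgroup Homeo_plus_subgroup
    by (rule group.subgroup_incl) (auto simp: Homeo_plus_p_def)
  show "Homeo_plus_top closure_of Homeo_plus_p = Homeo_plus"
  proof
    show "Homeo_plus_top closure_of Homeo_plus_p \<subseteq> Homeo_plus"
      using closure_of_subset_topspace topspace_Homeo_plus_top by metis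
    show "Homeo_plus \<subseteq> Homeo_plus_top closure_of Homeo_plus_p"
    proof
      fix f assume f: "f \<in> Homeo_plus"
      have "\<exists>g\<in>Homeo_plus_p. g \<in> U" if U: "f \<in> U" "openin Homeo_plus_top U" for U
      proof -
        obtain V where "openin solenoid_top V" "emb 0 \<in> V" "unif_nbhd f V \<subseteq> U"
          using U unfolding openin_Homeo_plus_top by blast
        then show ?thesis using Homeo_plus_p_approx[OF f] by (metis subsetD)
      qed
      then show "f \<in> Homeo_plus_top closure_of Homeo_plus_p"
        using f by (auto simp: in_closure_of topspace_Homeo_plus_top)
    qed
  qed
qed

end
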